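(* Let $n\ge 3$, $0<\theta\le\pi$, $0\le\phi\le\pi$, and let $d\ge 0$ be an integer. Let $$\Delta=\{(u,v,t)\in\mathbb{R}^3 : \cos\phi\le u\le v\le 1,\ -1\le t\le\cos\theta,\ 1+2uvt-u^2-v^2-t^2\ge 0\}.$$ Let $E_0$ be the $(d+1)\times(d+1)$ matrix whose only nonzero entry is the top left corner, which equals $1$. Let $F(u,v,t)\in R_d$ and let $(F_0,\dots,F_d)$ be real symmetric matrices, $F_k$ of size $(d-k+1)\times(d-k+1)$, such that $$F(u,v,t)=\sum_{k=0}^d\langle F_k,\overline{Y}_k^n(u,v,t)\rangle.$$ Suppose that, for some real numbers $f_0$ and $B$, the following conditions hold: (a) $F_k\succeq 0$ for all $0\le k\le d$; (b) $F_0-f_0E_0\succeq 0$ and $f_0>0$; (c) $F(u,v,t)\le 0$ for all $(u,v,t)\in\Delta$; (d) $F(u,u,1)\le B$ for all $u\in[\cos\phi,1]$. Then, for any code $C$ in $\operatorname{Cap}(e,\phi)$ with minimal angular distance at least $\theta$, $$\operatorname{card}(C)\le\frac{B}{f_0}.$$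
   Context: $S^{n-1}=\{x\in\mathbb{R}^n: x\cdot x=1\}$, and $e\in S^{n-1}$ is a fixed point. $\operatorname{Cap}(e,\phi)=\{x\in S^{n-1}: e\cdot x\ge\cos\phi\}$. A code is a finite set $C$; it has minimal angular distance at least $\theta$ if $c\cdot c'\le\cos\theta$ for all distinct $c,c'\in C$. $R_d=\{F\in\mathbb{R}[u,v,t] : F(u,v,t)=F(v,u,t),\ \deg_{(u,t)}(F)\le d,\ \deg_t(F)\le d\}$, where $\deg_{(u,t)}$ is the total degree in the variables $u,t$. Notation: $\langle A,B\rangle=\operatorname{Trace}(AB^t)$; $A\succeq 0$ means that the symmetric matrix $A$ is positive semidefinite. $\omega_m$ is the surface area of $S^{m-1}\subset\mathbb{R}^m$ (so $\omega_1=2$). $h_k^m$ is the dimension of the space of homogeneous harmonic real polynomials of degree $k$ in $m$ variables. For $m\ge 3$, $P_k^m(t)$ is the Gegenbauer polynomial of degree $k$ with parameter $m/2-1$, normalized by $P_k^m(1)=1$; for $m=2$, $P_k^2(t)$ is the Chebyshev polynomial of the first kind of degree $k$. For $0\le k\le d$, $Y_k^n(u,v,t)$ is the $(d-k+1)\times(d-k+1)$ matrix with entries indexed by $0\le i,j\le d-k$, $$(Y_k^n)_{i,j}(u,v,t)=\lambda_{i,j}\,P_i^{n+2k}(u)\,P_j^{n+2k}(v)\,Q_k^{n-1}(u,v,t),$$ where $$Q_k^{n-1}(u,v,t)=\big((1-u^2)(1-v^2)\big)^{k/2}P_k^{n-1}\Big(\tfrac{t-uv}{\sqrt{(1-u^2)(1-v^2)}}\Big)$$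 (a polynomial in $u,v,t$, and understood as such everywhere), and $$\lambda_{i,j}=\frac{\omega_n}{\omega_{n-1}}\frac{\omega_{n+2k-1}}{\omega_{n+2k}}\,(h_i^{n+2k}h_j^{n+2k})^{1/2}.$$ Finally $\overline{Y}_k^n(u,v,t)=\tfrac12\big(Y_k^n(u,v,t)+Y_k^n(v,u,t)\big)$. *)

theory Defs
  imports
    "Jordan_Normal_Form.Matrix"
    "HOL-Analysis.Analysis"
    "HOL-Computational_Algebra.Polynomial"
    "HOL-Library.Poly_Mapping"
begin

section \<open>Codes in spherical caps\<close>

definition Cap :: "real ^ 'n \<Rightarrow> real \<Rightarrow> (real ^ 'n) set" where
  "Cap e \<phi> = {x \<in> sphere 0 1. inner e x \<ge> cos \<phi>}"

definition min_angular_distance_ge :: "(real ^ 'n) set \<Rightarrow> real \<Rightarrow> bool" where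
  "min_angular_distance_ge C \<theta> \<longleftrightarrow>
     (\<forall>c \<in> C. \<forall>c' \<in> C. c \<noteq> c' \<longrightarrow> inner c c' \<le> cos \<theta>)"

definition Delta :: "real \<Rightarrow> real \<Rightarrow> (real \<times> real \<times> real) set" where
  "Delta \<theta> \<phi> = {(u, v, t). cos \<phi> \<le> u \<and> u \<le> v \<and> v \<le> 1 \<and> - 1 \<le> t \<and> t \<le> cos \<theta> \<and>
     1 + 2 * u * v * t - u\<^sup>2 - v\<^sup>2 - t\<^sup>2 \<ge> 0}"


section \<open>Polynomials in several variables\<close>

text \<open>Real polynomials with variables in \<open>'v\<close>: monomials are finitely supported exponent
  vectors, and polynomials are finitely supported coefficient functions on monomials.\<close>

type_synonym 'v rpoly = "('v \<Rightarrow>\<^sub>0 nat) \<Rightarrow>\<^sub>0 real"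

definition peval :: "('v \<Rightarrow> real) \<Rightarrow> 'v rpoly \<Rightarrow> real" where
  "peval x p = (\<Sum>\<alpha>\<in>Poly_Mapping.keys p.
     Poly_Mapping.lookup p \<alpha> * (\<Prod>i\<in>Poly_Mapping.keys \<alpha>. x i ^ Poly_Mapping.lookup \<alpha> i))"

datatype uvt = Var_u | Var_v | Var_t

definition eval_uvt :: "uvt rpoly \<Rightarrow> real \<Rightarrow> real \<Rightarrow> real \<Rightarrow> real" where
  "eval_uvt F u v t = peval (case_uvt u v t) F"

text \<open>The degree bounds are bounds on the monomials that occur, so the zero polynomial
  satisfies all of them.\<close>

definition R_poly :: "nat \<Rightarrow> uvt rpoly set" where
  "R_poly d = {F. (\<forall>u v t. eval_uvt F u v t = eval_uvt F v u t) \<and>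
             (\<forall>\<alpha>\<in>Poly_Mapping.keys F. Poly_Mapping.lookup \<alpha> Var_u + Poly_Mapping.lookup \<alpha> Var_t \<le> d) \<and>
             (\<forall>\<alpha>\<in>Poly_Mapping.keys F. Poly_Mapping.lookup \<alpha> Var_t \<le> d)}"


section \<open>Harmonic polynomials\<close>

definition pscale :: "real \<Rightarrow> 'v rpoly \<Rightarrow> 'v rpoly" where
  "pscale c = Poly_Mapping.map ((*) c)"

definition partial_deriv :: "'v \<Rightarrow> 'v rpoly \<Rightarrow> 'v rpoly" where
  "partial_deriv i p = (\<Sum>\<alpha>\<in>Poly_Mapping.keys p.
     Poly_Mapping.single (\<alpha> - Poly_Mapping.single i 1)
       (real (Poly_Mapping.lookup \<alpha> i) * Poly_Mapping.lookup p \<alpha>))"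

definition laplacian :: "nat \<Rightarrow> nat rpoly \<Rightarrow> nat rpoly" where
  "laplacian m p = (\<Sum>i<m. partial_deriv i (partial_deriv i p))"

text \<open>The variables of a polynomial in \<open>m\<close> variables are numbered \<open>0, \<dots>, m - 1\<close>.\<close>

definition homogeneous_harmonic :: "nat \<Rightarrow> nat \<Rightarrow> nat rpoly set" where
  "homogeneous_harmonic m k =
     {p. (\<forall>\<alpha>\<in>Poly_Mapping.keys p. Poly_Mapping.keys \<alpha> \<subseteq> {..<m} \<and>
            (\<Sum>i\<in>Poly_Mapping.keys \<alpha>. Poly_Mapping.lookup \<alpha> i) = k) \<and>
         laplacian m p = 0}"

definition harm_dim :: "nat \<Rightarrow> nat \<Rightarrow> nat" where
  "harm_dim m k = vector_space.dim pscale (homogeneous_harmonic m k)"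

lemma lookup_pscale [simp]: "Poly_Mapping.lookup (pscale c p) \<alpha> = c * Poly_Mapping.lookup p \<alpha>"
  by (simp add: pscale_def Poly_Mapping.map.rep_eq when_def)

lemma vector_space_pscale: "vector_space (pscale :: real \<Rightarrow> 'v rpoly \<Rightarrow> 'v rpoly)"
  by unfold_locales (auto intro!: poly_mapping_eqI simp: lookup_add algebra_simps)

lemma harm_dim_0: "harm_dim m 0 = 1"
proof -
  interpret vector_space "pscale :: real \<Rightarrow> nat rpoly \<Rightarrow> nat rpoly"
    by (rule vector_space_pscale)
  have eq: "homogeneous_harmonic m 0 = span {1}"
  proof (intro equalityI subsetI)
    fix p assume "p \<in> homogeneous_harmonic m 0"
    then have k: "\<alpha> = 0" if "\<alpha> \<in> Poly_Mapping.keys p" for \<alpha>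
      using that by (fastforce simp: homogeneous_harmonic_def in_keys_iff intro!: poly_mapping_eqI)
    have "p = pscale (Poly_Mapping.lookup p 0) 1"
    proof (rule poly_mapping_eqI)
      fix \<alpha>
      show "Poly_Mapping.lookup p \<alpha> = Poly_Mapping.lookup (pscale (Poly_Mapping.lookup p 0) 1) \<alpha>"
        using k[of \<alpha>] by (cases "\<alpha> = 0") (auto simp: in_keys_iff lookup_one when_def)
    qed
    then show "p \<in> span {1}"
      by (metis insertI1 span_base span_scale)
  next
    fix p :: "nat rpoly" assume "p \<in> span {1}"
    then obtain c where c: "p = pscale c 1"
      by (auto simp: span_singleton)
    have keys: "Poly_Mapping.keys p \<subseteq> {0}"
      by (auto simp: c in_keys_iff lookup_one when_def split: if_splits)
    then have "partial_deriv i p = 0" for i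
      unfolding partial_deriv_def by (intro sum.neutral) auto
    moreover have "partial_deriv i (0 :: nat rpoly) = 0" for i
      by (simp add: partial_deriv_def)
    ultimately show "p \<in> homogeneous_harmonic m 0"
      using keys by (auto simp: homogeneous_harmonic_def laplacian_def)
  qed
  have "(1 :: nat rpoly) \<noteq> 0"
    by simp
  then have "dim (span {1 :: nat rpoly}) = 1"
    by (subst dim_eq_card[of "{1}"]) (auto simp: span_span)
  then show ?thesis
    by (simp add: harm_dim_def eq)
qed


section \<open>Surface area of the sphere\<close>

definition unit_sphere :: "nat \<Rightarrow> (nat \<Rightarrow> real) set" where
  "unit_sphere m = {x \<in> {..<m} \<rightarrow>\<^sub>E UNIV. (\<Sum>i<m. (x i)\<^sup>2) = 1}"

text \<open>Surface measure is given by polar coordinates: the area of a subset of the unit sphere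
  of \<open>\<real>\<^sup>m\<close> is \<open>m\<close> times the Lebesgue measure of the cone over it with apex \<open>0\<close>.\<close>

definition surface_area :: "nat \<Rightarrow> (nat \<Rightarrow> real) set \<Rightarrow> real" where
  "surface_area m A = real m * measure (\<Pi>\<^sub>M i\<in>{..<m}. lborel)
     {\<lambda>i\<in>{..<m}. r * x i | r x. 0 \<le> r \<and> r \<le> 1 \<and> x \<in> A}"

definition \<omega> :: "nat \<Rightarrow> real" where
  "\<omega> m = surface_area m (unit_sphere m)"

lemma omega_eq:
  assumes "m \<ge> 1"
  shows "\<omega> m = 2 * pi powr (real m / 2) / Gamma (real m / 2)"
proof -
  have cone: "{\<lambda>i\<in>{..<m}. r * x i | r x. 0 \<le> r \<and> r \<le> 1 \<and> x \<in> unit_sphere m}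
      = {f \<in> {..<m} \<rightarrow>\<^sub>E UNIV. sqrt (\<Sum>i<m. (f i)\<^sup>2) \<le> 1}" (is "?A = ?B")
  proof (intro equalityI subsetI)
    fix f assume "f \<in> ?A"
    then obtain r x where f: "f = (\<lambda>i\<in>{..<m}. r * x i)" "0 \<le> r" "r \<le> 1" "x \<in> unit_sphere m"
      by blast
    have "(\<Sum>i<m. (f i)\<^sup>2) = r\<^sup>2 * (\<Sum>i<m. (x i)\<^sup>2)"
      by (simp add: f(1) power_mult_distrib sum_distrib_left)
    also have "\<dots> = r\<^sup>2"
      using f(4) by (simp add: unit_sphere_def)
    finally show "f \<in> ?B"
      using f(1-3) by (simp add: power_le_one)
  next
    fix f assume f: "f \<in> ?B"
    define r where "r = sqrt (\<Sum>i<m. (f i)\<^sup>2)"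
    have r: "0 \<le> r" "r \<le> 1" "r\<^sup>2 = (\<Sum>i<m. (f i)\<^sup>2)"
      using f by (auto simp: r_def sum_nonneg)
    show "f \<in> ?A"
    proof (cases "r = 0")
      case True
      then have z: "f i = 0" if "i < m" for i
        using r(3) that by (simp add: sum_nonneg_eq_0_iff)
      define x where "x = (\<lambda>i\<in>{..<m}. if i = 0 then 1 else 0 :: real)"
      have "(\<Sum>i<m. (x i)\<^sup>2) = (\<Sum>i<m. if i = 0 then 1 else 0)"
        by (intro sum.cong) (auto simp: x_def)
      also have "\<dots> = 1"
        using assms by simp
      finally have "x \<in> unit_sphere m"
        by (auto simp: unit_sphere_def x_def)
      moreover have "f = (\<lambda>i\<in>{..<m}. 0 * x i)"
        using f z by (auto simp: PiE_def extensional_def restrict_def fun_eq_iff)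
      ultimately show ?thesis
        by (intro CollectI exI[of _ 0] exI[of _ x]) auto
    next
      case False
      define x where "x = (\<lambda>i\<in>{..<m}. f i / r)"
      have "(\<Sum>i<m. (x i)\<^sup>2) = (\<Sum>i<m. (f i)\<^sup>2) / r\<^sup>2"
        by (simp add: x_def power_divide sum_divide_distrib)
      then have "x \<in> unit_sphere m"
        using False r(3) by (auto simp: unit_sphere_def x_def)
      moreover have "f = (\<lambda>i\<in>{..<m}. r * x i)"
        using f False by (auto simp: x_def PiE_def extensional_def restrict_def fun_eq_iff)
      ultimately show ?thesis
        using r by blast
    qed
  qed
  have "emeasure (\<Pi>\<^sub>M i\<in>{..<m}. lborel) ({f. sqrt (\<Sum>i<m. (f i)\<^sup>2) \<le> 1} \<inter> space (\<Pi>\<^sub>M i\<in>{..<m}. lborel))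
      = ennreal (unit_ball_vol (real (card {..<m})) * 1 ^ card {..<m})"
    by (rule emeasure_cball_aux) (use assms in auto)
  moreover have "{f. sqrt (\<Sum>i<m. (f i)\<^sup>2) \<le> 1} \<inter> space (\<Pi>\<^sub>M i\<in>{..<m}. lborel)
      = {f \<in> {..<m} \<rightarrow>\<^sub>E UNIV. sqrt (\<Sum>i<m. (f i)\<^sup>2) \<le> (1::real)}"
    by (auto simp: space_PiM)
  ultimately have "\<omega> m = real m * unit_ball_vol (real m)"
    by (simp add: \<omega>_def surface_area_def cone measure_def)
  also have "Gamma (real m / 2 + 1) = real m / 2 * Gamma (real m / 2)"
    using assms by (intro Gamma_plus1) (auto dest: nonpos_Ints_nonpos)
  then have "real m * unit_ball_vol (real m) = 2 * pi powr (real m / 2) / Gamma (real m / 2)"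
    using assms Gamma_real_pos[of "real m / 2"]
    by (auto simp: unit_ball_vol_def divide_simps)
  finally show ?thesis .
qed


section \<open>Gegenbauer polynomials\<close>

fun chebyshev_T :: "nat \<Rightarrow> real poly" where
  "chebyshev_T 0 = 1"
| "chebyshev_T (Suc 0) = [:0, 1:]"
| "chebyshev_T (Suc (Suc k)) = [:0, 2:] * chebyshev_T (Suc k) - chebyshev_T k"

text \<open>The classical, unnormalized Gegenbauer polynomials with parameter \<open>a\<close>.\<close>

fun gegenbauer :: "real \<Rightarrow> nat \<Rightarrow> real poly" where
  "gegenbauer a 0 = 1"
| "gegenbauer a (Suc 0) = [:0, 2 * a:]"
| "gegenbauer a (Suc (Suc k)) =
     smult (1 / (real k + 2))
       ([:0, 2 * (real k + 1 + a):] * gegenbauer a (Suc k)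
        - smult (real k + 2 * a) (gegenbauer a k))"

text \<open>Only \<open>m \<ge> 2\<close> is meaningful.\<close>

definition gegen_P :: "nat \<Rightarrow> nat \<Rightarrow> real poly" where
  "gegen_P m k = (if m = 2 then chebyshev_T k
            else let C = gegenbauer (real m / 2 - 1) k in smult (1 / poly C 1) C)"

lemma poly_chebyshev_T_1 [simp]: "poly (chebyshev_T k) 1 = 1"
  by (induction k rule: chebyshev_T.induct) auto

lemma poly_gegenbauer_1: "poly (gegenbauer a k) 1 = pochhammer (2 * a) k / fact k"
proof (induction a k rule: gegenbauer.induct)
  case (3 a k)
  have ne: "real k + 1 \<noteq> 0" "real k + 2 \<noteq> 0" "(fact k :: real) \<noteq> 0"
    by auto
  show ?case
    using ne by (simp add: 3 pochhammer_Suc divide_simps) (simp add: algebra_simps)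
qed auto

lemma poly_P_1:
  assumes "m \<ge> 2"
  shows "poly (gegen_P m k) 1 = 1"
proof (cases "m = 2")
  case False
  then have "pochhammer (2 * (real m / 2 - 1)) k > 0"
    using assms by (intro pochhammer_pos) auto
  then show ?thesis
    using False by (simp add: gegen_P_def Let_def poly_gegenbauer_1)
qed (simp add: gegen_P_def)

lemma degree_chebyshev_T: "Polynomial.degree (chebyshev_T k) \<le> k"
proof (induction k rule: chebyshev_T.induct)
  case (3 k)
  have "Polynomial.degree ([:0, 2:] * chebyshev_T (Suc k)) \<le> Suc (Suc k)"
    by (rule order.trans[OF degree_mult_le]) (use 3 in simp)
  then show ?case
    using 3 by (auto intro!: degree_diff_le)
qed auto

lemma degree_gegenbauer: "Polynomial.degree (gegenbauer a k) \<le> k"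
proof (induction a k rule: gegenbauer.induct)
  case (3 a k)
  have "Polynomial.degree ([:0, 2 * (real k + 1 + a):] * gegenbauer a (Suc k)) \<le> Suc (Suc k)"
    by (rule order.trans[OF degree_mult_le]) (use 3 in \<open>auto split: if_splits\<close>)
  moreover have "Polynomial.degree (smult (real k + 2 * a) (gegenbauer a k)) \<le> Suc (Suc k)"
    using 3 by (intro order.trans[OF degree_smult_le]) auto
  ultimately show ?case
    unfolding gegenbauer.simps
    by (intro order.trans[OF degree_smult_le degree_diff_le]) simp_all
qed auto

lemma coeff_chebyshev_T_parity: "odd (k + j) \<Longrightarrow> coeff (chebyshev_T k) j = 0"
  by (induction k arbitrary: j rule: chebyshev_T.induct)
     (auto simp: coeff_pCons odd_pos split: nat.splits)

lemma coeff_gegenbauer_parity: "odd (k + j) \<Longrightarrow> coeff (gegenbauer a k) j = 0"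
  by (induction a k arbitrary: j rule: gegenbauer.induct)
     (auto simp: coeff_pCons odd_pos split: nat.splits)

lemma degree_P: "Polynomial.degree (gegen_P m k) \<le> k"
  by (auto simp: gegen_P_def Let_def degree_chebyshev_T degree_gegenbauer)

lemma coeff_P_parity: "odd (k + j) \<Longrightarrow> coeff (gegen_P m k) j = 0"
  by (auto simp: gegen_P_def Let_def coeff_chebyshev_T_parity coeff_gegenbauer_parity)


section \<open>The polynomials Q and the matrices Y\<close>

text \<open>The polynomial extending
  \<open>((1 - u\<^sup>2) (1 - v\<^sup>2)) powr (k / 2) * gegen_P m k ((t - u v) / sqrt ((1 - u\<^sup>2) (1 - v\<^sup>2)))\<close>.
  Since \<open>gegen_P m k\<close> has the parity of \<open>k\<close>, only those \<open>j\<close> with \<open>k - j\<close> even contribute.\<close>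

definition Q_poly :: "nat \<Rightarrow> nat \<Rightarrow> real \<Rightarrow> real \<Rightarrow> real \<Rightarrow> real" where
  "Q_poly m k u v t = (\<Sum>j\<le>k. coeff (gegen_P m k) j * (t - u * v) ^ j *
     ((1 - u\<^sup>2) * (1 - v\<^sup>2)) ^ ((k - j) div 2))"

lemma Q_eq:
  assumes "(1 - u\<^sup>2) * (1 - v\<^sup>2) > 0"
  shows "Q_poly m k u v t = ((1 - u\<^sup>2) * (1 - v\<^sup>2)) powr (real k / 2) *
           poly (gegen_P m k) ((t - u * v) / sqrt ((1 - u\<^sup>2) * (1 - v\<^sup>2)))"
proof -
  define s where "s = sqrt ((1 - u\<^sup>2) * (1 - v\<^sup>2))"
  have s: "s > 0" and s2: "(1 - u\<^sup>2) * (1 - v\<^sup>2) = s\<^sup>2"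
    using assms by (auto simp: s_def)
  have "s\<^sup>2 powr (real k / 2) = (s powr 2) powr (real k / 2)"
    using s by simp
  also have "\<dots> = s ^ k"
    using s by (simp only: powr_powr) (simp add: powr_realpow)
  finally have "s\<^sup>2 powr (real k / 2) = s ^ k" .
  moreover have "poly (gegen_P m k) x = (\<Sum>j\<le>k. coeff (gegen_P m k) j * x ^ j)" for x
    unfolding poly_altdef
    by (intro sum.mono_neutral_left) (use degree_P[of m k] in \<open>auto simp: coeff_eq_0\<close>)
  ultimately have "((1 - u\<^sup>2) * (1 - v\<^sup>2)) powr (real k / 2) * poly (gegen_P m k) ((t - u * v) / s)
      = s ^ k * (\<Sum>j\<le>k. coeff (gegen_P m k) j * ((t - u * v) / s) ^ j)"
    by (simp add: s2)
  also have "\<dots> = (\<Sum>j\<le>k. coeff (gegen_P m k) j * (t - u * v) ^ j * (s\<^sup>2) ^ ((k - j) div 2))"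
    unfolding sum_distrib_left
  proof (intro sum.cong refl)
    fix j assume "j \<in> {..k}"
    then have j: "j \<le> k" by simp
    show "s ^ k * (coeff (gegen_P m k) j * ((t - u * v) / s) ^ j)
        = coeff (gegen_P m k) j * (t - u * v) ^ j * (s\<^sup>2) ^ ((k - j) div 2)"
    proof (cases "even (k + j)")
      case True
      then have "even (k - j)" using j by simp
      then have "(s\<^sup>2) ^ ((k - j) div 2) = s ^ (k - j)"
        by (simp add: power_mult[symmetric])
      also have "\<dots> = s ^ k / s ^ j"
        using s j by (simp add: power_diff)
      finally show ?thesis
        using s by (simp add: power_divide)
    qed (simp add: coeff_P_parity)
  qed
  finally show ?thesis
    using s by (simp add: Q_poly_def s2)
qed

definition lam :: "nat \<Rightarrow> nat \<Rightarrow> nat \<Rightarrow> nat \<Rightarrow> real" where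
  "lam n k i j = \<omega> n / \<omega> (n - 1) * (\<omega> (n + 2 * k - 1) / \<omega> (n + 2 * k)) *
     sqrt (real (harm_dim (n + 2 * k) i) * real (harm_dim (n + 2 * k) j))"

definition Y_mat :: "nat \<Rightarrow> nat \<Rightarrow> nat \<Rightarrow> real \<Rightarrow> real \<Rightarrow> real \<Rightarrow> real mat" where
  "Y_mat n d k u v t = Matrix.mat (d - k + 1) (d - k + 1) (\<lambda>(i, j).
     lam n k i j * poly (gegen_P (n + 2 * k) i) u * poly (gegen_P (n + 2 * k) j) v *
     Q_poly (n - 1) k u v t)"

definition Ybar_mat :: "nat \<Rightarrow> nat \<Rightarrow> nat \<Rightarrow> real \<Rightarrow> real \<Rightarrow> real \<Rightarrow> real mat" where
  "Ybar_mat n d k u v t = (1 / 2) \<cdot>\<^sub>m (Y_mat n d k u v t + Y_mat n d k v u t)"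


section \<open>Symmetric matrices\<close>

definition trace_mat :: "real mat \<Rightarrow> real" where
  "trace_mat A = (\<Sum>i<dim_row A. A $$ (i, i))"

definition mat_inner :: "real mat \<Rightarrow> real mat \<Rightarrow> real" where
  "mat_inner A B = trace_mat (A * B\<^sup>T)"

definition sym_mat :: "nat \<Rightarrow> real mat \<Rightarrow> bool" where
  "sym_mat N A \<longleftrightarrow> A \<in> carrier_mat N N \<and> A\<^sup>T = A"

definition psd :: "nat \<Rightarrow> real mat \<Rightarrow> bool" where
  "psd N A \<longleftrightarrow> sym_mat N A \<and> (\<forall>x \<in> carrier_vec N. scalar_prod x (A *\<^sub>v x) \<ge> 0)"

definition E0 :: "nat \<Rightarrow> real mat" where
  "E0 d = Matrix.mat (d + 1) (d + 1) (\<lambda>(i, j). if i = 0 \<and> j = 0 then 1 else 0)"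

end

theory Submission
  imports Defs
begin

text \<open>
  The proof is a double count of \<open>\<Sum> F(e \<cdot> c, e \<cdot> c', c \<cdot> c')\<close> over all pairs of code points. The terms
  with \<open>c = c'\<close> are at most \<open>B\<close>. For \<open>c \<noteq> c'\<close> the triple lies in the region \<open>\<Delta>\<close>, after exchanging
  \<open>c\<close> and \<open>c'\<close> if necessary, and the term is at most 0. Hence the sum is at most \<open>B card C\<close>. On the
  other hand it is at least \<open>f\<^sub>0 (card C)\<^sup>2\<close> (\<open>sum_eval_uvt_ge\<close>), because
  \<open>\<Sum> \<langle>G, Y\<^sub>k(e \<cdot> c, e \<cdot> c', c \<cdot> c')\<rangle> \<ge> 0\<close> for every positive semidefinite \<open>G\<close>
  (\<open>sum_mat_inner_Ybar_nonneg\<close>).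

  This positivity rests on one analytic fact: \<open>Q\<^sub>k(e \<cdot> x, e \<cdot> y, x \<cdot> y)\<close> is a positive semidefinite
  kernel on the sphere. It is the zonal harmonic kernel of degree \<open>k\<close> in the \<open>n - 1\<close> dimensional
  space orthogonal to \<open>e\<close>, evaluated at the projections of \<open>x\<close> and \<open>y\<close> to that space. Its positivity is
  usually read off from the addition formula for spherical harmonics. The argument here is
  more elementary, and avoids integration on spheres and bases of harmonic polynomials. For a
  harmonic polynomial \<open>h\<close> of degree \<open>k\<close> in \<open>m\<close> variables, the harmonic part of \<open>x\<^sub>b h\<close> is
  \<open>A\<^sub>b h = x\<^sub>b h - \<alpha> \<bar>x\<bar>\<^sup>2 \<partial>\<^sub>b h\<close> with \<open>\<alpha> = 1 / (2 k + m - 2)\<close>, and the zonal kernels \<open>K\<^sub>k\<close> satisfy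
  \<open>\<Sum>\<^sub>b A\<^sub>b\<^sup>x A\<^sub>b\<^sup>y K\<^sub>k = c K\<^sub>k\<^sub>+\<^sub>1\<close> with some \<open>c > 0\<close>. If \<open>K\<^sub>k(x, y) = \<Sum>\<^sub>i \<phi>\<^sub>i(x) \<phi>\<^sub>i(y)\<close>, then the left-hand
  side is \<open>\<Sum>\<^sub>b\<^sub>,\<^sub>i (A\<^sub>b \<phi>\<^sub>i)(x) (A\<^sub>b \<phi>\<^sub>i)(y)\<close>, so such a representation passes from degree \<open>k\<close> to degree
  \<open>k + 1\<close> (\<open>gram_kernel_zonal\<close>). The identity itself is one about Gegenbauer polynomials in the
  variables \<open>s = x \<cdot> y\<close> and \<open>r = \<bar>x\<bar>\<^sup>2 \<bar>y\<bar>\<^sup>2\<close> (\<open>zonal_raising_contraction\<close>), and follows from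
  homogeneity, the Gegenbauer differential equation and a raising relation.
\<close>

section \<open>Homogeneous Gegenbauer polynomials\<close>

text \<open>The Gegenbauer polynomial of degree \<open>k\<close> in dimension \<open>m = \<mu> + 2\<close> with value \<open>1\<close> at \<open>1\<close>,
  made homogeneous by giving \<open>s\<close> weight 1 and \<open>r\<close> weight 2. With \<open>s = x \<cdot> y\<close> and
  \<open>r = \<bar>x\<bar>\<^sup>2 \<bar>y\<bar>\<^sup>2\<close> it is the zonal harmonic with pole \<open>y\<close>. In this normalization one
  recurrence covers \<open>\<mu> = 0\<close>, the Chebyshev case, as well; only the step from degree 0 to
  degree 1, where it would read \<open>0 = 0\<close> for \<open>\<mu> = 0\<close>, has to be prescribed separately.\<close>

fun zonal :: "real \<Rightarrow> nat \<Rightarrow> real \<Rightarrow> real \<Rightarrow> real" where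
  "zonal \<mu> 0 s r = 1"
| "zonal \<mu> (Suc 0) s r = s"
| "zonal \<mu> (Suc (Suc k)) s r =
     ((2 * (real k + 1) + \<mu>) * s * zonal \<mu> (Suc k) s r - (real k + 1) * r * zonal \<mu> k s r)
       / (real k + 1 + \<mu>)"

text \<open>The first and second partial derivatives in \<open>s\<close> and \<open>r\<close>, given by the differentiated
  recurrence.\<close>

fun zonal_s :: "real \<Rightarrow> nat \<Rightarrow> real \<Rightarrow> real \<Rightarrow> real" where
  "zonal_s \<mu> 0 s r = 0"
| "zonal_s \<mu> (Suc 0) s r = 1"
| "zonal_s \<mu> (Suc (Suc k)) s r =
     ((2 * (real k + 1) + \<mu>) * (zonal \<mu> (Suc k) s r + s * zonal_s \<mu> (Suc k) s r)
       - (real k + 1) * r * zonal_s \<mu> k s r) / (real k + 1 + \<mu>)"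

fun zonal_r :: "real \<Rightarrow> nat \<Rightarrow> real \<Rightarrow> real \<Rightarrow> real" where
  "zonal_r \<mu> 0 s r = 0"
| "zonal_r \<mu> (Suc 0) s r = 0"
| "zonal_r \<mu> (Suc (Suc k)) s r =
     ((2 * (real k + 1) + \<mu>) * s * zonal_r \<mu> (Suc k) s r
       - (real k + 1) * (zonal \<mu> k s r + r * zonal_r \<mu> k s r)) / (real k + 1 + \<mu>)"

fun zonal_ss :: "real \<Rightarrow> nat \<Rightarrow> real \<Rightarrow> real \<Rightarrow> real" where
  "zonal_ss \<mu> 0 s r = 0"
| "zonal_ss \<mu> (Suc 0) s r = 0"
| "zonal_ss \<mu> (Suc (Suc k)) s r =
     ((2 * (real k + 1) + \<mu>) * (2 * zonal_s \<mu> (Suc k) s r + s * zonal_ss \<mu> (Suc k) s r)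
       - (real k + 1) * r * zonal_ss \<mu> k s r) / (real k + 1 + \<mu>)"

fun zonal_sr :: "real \<Rightarrow> nat \<Rightarrow> real \<Rightarrow> real \<Rightarrow> real" where
  "zonal_sr \<mu> 0 s r = 0"
| "zonal_sr \<mu> (Suc 0) s r = 0"
| "zonal_sr \<mu> (Suc (Suc k)) s r =
     ((2 * (real k + 1) + \<mu>) * (zonal_r \<mu> (Suc k) s r + s * zonal_sr \<mu> (Suc k) s r)
       - (real k + 1) * (zonal_s \<mu> k s r + r * zonal_sr \<mu> k s r)) / (real k + 1 + \<mu>)"

fun zonal_rr :: "real \<Rightarrow> nat \<Rightarrow> real \<Rightarrow> real \<Rightarrow> real" where
  "zonal_rr \<mu> 0 s r = 0"
| "zonal_rr \<mu> (Suc 0) s r = 0"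
| "zonal_rr \<mu> (Suc (Suc k)) s r =
     ((2 * (real k + 1) + \<mu>) * s * zonal_rr \<mu> (Suc k) s r
       - (real k + 1) * (2 * zonal_r \<mu> k s r + r * zonal_rr \<mu> k s r)) / (real k + 1 + \<mu>)"

lemma DERIV_zonal:
  assumes "(f has_real_derivative f') (at h)" "(g has_real_derivative g') (at h)"
  shows "((\<lambda>h. zonal \<mu> k (f h) (g h)) has_real_derivative
           zonal_s \<mu> k (f h) (g h) * f' + zonal_r \<mu> k (f h) (g h) * g') (at h)"
proof (induction \<mu> k "f h" "g h" rule: zonal.induct)
  case (3 \<mu> k)
  note [derivative_intros] = 3 assms
  show ?case
    unfolding zonal.simps
    by (rule DERIV_cong[OF DERIV_cdivide], (rule derivative_eq_intros refl)+)
       (simp add: divide_inverse algebra_simps)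
qed (use assms in auto)

lemma DERIV_zonal_s:
  assumes "(f has_real_derivative f') (at h)" "(g has_real_derivative g') (at h)"
  shows "((\<lambda>h. zonal_s \<mu> k (f h) (g h)) has_real_derivative
           zonal_ss \<mu> k (f h) (g h) * f' + zonal_sr \<mu> k (f h) (g h) * g') (at h)"
proof (induction \<mu> k "f h" "g h" rule: zonal_s.induct)
  case (3 \<mu> k)
  note [derivative_intros] = 3 assms DERIV_zonal[OF assms]
  show ?case
    unfolding zonal_s.simps
    by (rule DERIV_cong[OF DERIV_cdivide], (rule derivative_eq_intros refl)+)
       (simp add: divide_inverse algebra_simps)
qed (use assms in auto)

lemma DERIV_zonal_r:
  assumes "(f has_real_derivative f') (at h)" "(g has_real_derivative g') (at h)"
  shows "((\<lambda>h. zonal_r \<mu> k (f h) (g h)) has_real_derivative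
           zonal_sr \<mu> k (f h) (g h) * f' + zonal_rr \<mu> k (f h) (g h) * g') (at h)"
proof (induction \<mu> k "f h" "g h" rule: zonal_r.induct)
  case (3 \<mu> k)
  note [derivative_intros] = 3 assms DERIV_zonal[OF assms]
  show ?case
    unfolding zonal_r.simps
    by (rule DERIV_cong[OF DERIV_cdivide], (rule derivative_eq_intros refl)+)
       (simp add: divide_inverse algebra_simps)
qed (use assms in auto)

text \<open>Written with right-hand side 0: each identity below is checked by displaying the difference
  of its sides as an explicit combination of expressions known to vanish.\<close>

lemma zonal_recurrences:
  assumes "\<mu> \<ge> 0"
  shows "(real k + 1 + \<mu>) * zonal \<mu> (Suc (Suc k)) s r -
           ((2 * (real k + 1) + \<mu>) * s * zonal \<mu> (Suc k) s r - (real k + 1) * r * zonal \<mu> k s r) = 0"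
    and "(real k + 1 + \<mu>) * zonal_s \<mu> (Suc (Suc k)) s r -
           ((2 * (real k + 1) + \<mu>) * (zonal \<mu> (Suc k) s r + s * zonal_s \<mu> (Suc k) s r)
             - (real k + 1) * r * zonal_s \<mu> k s r) = 0"
    and "(real k + 1 + \<mu>) * zonal_r \<mu> (Suc (Suc k)) s r -
           ((2 * (real k + 1) + \<mu>) * s * zonal_r \<mu> (Suc k) s r
             - (real k + 1) * (zonal \<mu> k s r + r * zonal_r \<mu> k s r)) = 0"
  using assms by simp_all

\<comment> \<open>The defining equations contain divisions; from here on only the recurrences cleared of
  denominators serve for computation.\<close>
declare zonal.simps(3) [simp del] zonal_s.simps(3) [simp del] zonal_r.simps(3) [simp del]

text \<open>Homogeneity, in the form of Euler's identity; differentiating it in \<open>s\<close> and in \<open>r\<close> gives the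
  next two lemmas.\<close>

lemma zonal_Euler:
  assumes "\<mu> \<ge> 0"
  shows "s * zonal_s \<mu> k s r + 2 * r * zonal_r \<mu> k s r = real k * zonal \<mu> k s r"
proof (induction k rule: induct_nat_012)
  case (ge2 k)
  let ?\<kappa> = "real k" and ?z0 = "zonal \<mu> k s r" and ?z1 = "zonal \<mu> (Suc k) s r"
    and ?z2 = "zonal \<mu> (Suc (Suc k)) s r" and ?zs0 = "zonal_s \<mu> k s r"
    and ?zs1 = "zonal_s \<mu> (Suc k) s r" and ?zs2 = "zonal_s \<mu> (Suc (Suc k)) s r"
    and ?zr0 = "zonal_r \<mu> k s r" and ?zr1 = "zonal_r \<mu> (Suc k) s r"
    and ?zr2 = "zonal_r \<mu> (Suc (Suc k)) s r"
  have IH: "s * ?zs0 + 2 * r * ?zr0 - ?\<kappa> * ?z0 = 0" "s * ?zs1 + 2 * r * ?zr1 - (?\<kappa> + 1) * ?z1 = 0"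
    using ge2 by (simp_all add: algebra_simps)
  have "(?\<kappa> + 1 + \<mu>) * (s * ?zs2 + 2 * r * ?zr2 - (?\<kappa> + 2) * ?z2)
      = s * ((?\<kappa> + 1 + \<mu>) * ?zs2 - ((2 * (?\<kappa> + 1) + \<mu>) * (?z1 + s * ?zs1) - (?\<kappa> + 1) * r * ?zs0))
      + 2 * r * ((?\<kappa> + 1 + \<mu>) * ?zr2 - ((2 * (?\<kappa> + 1) + \<mu>) * s * ?zr1 - (?\<kappa> + 1) * (?z0 + r * ?zr0)))
      - (?\<kappa> + 2) * ((?\<kappa> + 1 + \<mu>) * ?z2 - ((2 * (?\<kappa> + 1) + \<mu>) * s * ?z1 - (?\<kappa> + 1) * r * ?z0))
      + (2 * (?\<kappa> + 1) + \<mu>) * s * (s * ?zs1 + 2 * r * ?zr1 - (?\<kappa> + 1) * ?z1)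
      - (?\<kappa> + 1) * r * (s * ?zs0 + 2 * r * ?zr0 - ?\<kappa> * ?z0)"
    by (simp add: algebra_simps)
  also have "\<dots> = 0"
    by (simp only: zonal_recurrences[OF assms] IH)
  finally have "s * ?zs2 + 2 * r * ?zr2 - (?\<kappa> + 2) * ?z2 = 0"
    using assms by simp
  then show ?case
    by (simp add: algebra_simps)
qed auto

lemma zonal_s_Euler:
  assumes "\<mu> \<ge> 0"
  shows "s * zonal_ss \<mu> k s r + 2 * r * zonal_sr \<mu> k s r = (real k - 1) * zonal_s \<mu> k s r"
proof -
  have "((\<lambda>s. s * zonal_s \<mu> k s r + 2 * r * zonal_r \<mu> k s r) has_real_derivative
          s * zonal_ss \<mu> k s r + 2 * r * zonal_sr \<mu> k s r + zonal_s \<mu> k s r) (at s)"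
    by (rule derivative_eq_intros DERIV_zonal_s DERIV_zonal_r refl | simp)+
  moreover have "((\<lambda>s. real k * zonal \<mu> k s r) has_real_derivative real k * zonal_s \<mu> k s r) (at s)"
    by (rule derivative_eq_intros DERIV_zonal refl | simp)+
  ultimately have "s * zonal_ss \<mu> k s r + 2 * r * zonal_sr \<mu> k s r + zonal_s \<mu> k s r = real k * zonal_s \<mu> k s r"
    unfolding zonal_Euler[OF assms] by (rule DERIV_unique)
  then show ?thesis by (simp add: algebra_simps)
qed

lemma zonal_r_Euler:
  assumes "\<mu> \<ge> 0"
  shows "s * zonal_sr \<mu> k s r + 2 * r * zonal_rr \<mu> k s r = (real k - 2) * zonal_r \<mu> k s r"
proof -
  have "((\<lambda>r. s * zonal_s \<mu> k s r + 2 * r * zonal_r \<mu> k s r) has_real_derivative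
          s * zonal_sr \<mu> k s r + 2 * r * zonal_rr \<mu> k s r + 2 * zonal_r \<mu> k s r) (at r)"
    by (rule derivative_eq_intros DERIV_zonal_s DERIV_zonal_r refl | simp)+
  moreover have "((\<lambda>r. real k * zonal \<mu> k s r) has_real_derivative real k * zonal_r \<mu> k s r) (at r)"
    by (rule derivative_eq_intros DERIV_zonal refl | simp)+
  ultimately have "s * zonal_sr \<mu> k s r + 2 * r * zonal_rr \<mu> k s r + 2 * zonal_r \<mu> k s r = real k * zonal_r \<mu> k s r"
    unfolding zonal_Euler[OF assms] by (rule DERIV_unique)
  then show ?thesis by (simp add: algebra_simps)
qed

text \<open>The first-order relations between neighbouring degrees. They are proved simultaneously because
  the induction step for each draws on another one in the preceding degree.\<close>

lemma zonal_ladder: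
  assumes "\<mu> \<ge> 0"
  shows "(r - s\<^sup>2) * zonal_s \<mu> (Suc k) s r = (real k + 1) * (r * zonal \<mu> k s r - s * zonal \<mu> (Suc k) s r)
       \<and> (real k + 1) * r * zonal_s \<mu> k s r
            = (real k + \<mu>) * (s * zonal_s \<mu> (Suc k) s r - (real k + 1) * zonal \<mu> (Suc k) s r)
       \<and> (r - s\<^sup>2) * zonal_s \<mu> k s r = (real k + \<mu>) * (s * zonal \<mu> k s r - zonal \<mu> (Suc k) s r)"
proof (induction k)
  case (Suc k)
  let ?\<kappa> = "real k" and ?z0 = "zonal \<mu> k s r" and ?z1 = "zonal \<mu> (Suc k) s r"
    and ?z2 = "zonal \<mu> (Suc (Suc k)) s r" and ?zs0 = "zonal_s \<mu> k s r"
    and ?zs1 = "zonal_s \<mu> (Suc k) s r" and ?zs2 = "zonal_s \<mu> (Suc (Suc k)) s r"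
  have IH: "(r - s\<^sup>2) * ?zs1 - (?\<kappa> + 1) * (r * ?z0 - s * ?z1) = 0"
     "(?\<kappa> + 1) * r * ?zs0 - (?\<kappa> + \<mu>) * (s * ?zs1 - (?\<kappa> + 1) * ?z1) = 0"
     "(r - s\<^sup>2) * ?zs0 - (?\<kappa> + \<mu>) * (s * ?z0 - ?z1) = 0"
    using Suc by simp_all
  have "(?\<kappa> + 1 + \<mu>) * ((r - s\<^sup>2) * ?zs2 - (?\<kappa> + 2) * (r * ?z1 - s * ?z2))
      = (r - s\<^sup>2) * ((?\<kappa> + 1 + \<mu>) * ?zs2 - ((2 * (?\<kappa> + 1) + \<mu>) * (?z1 + s * ?zs1) - (?\<kappa> + 1) * r * ?zs0))
      + (?\<kappa> + 2) * s * ((?\<kappa> + 1 + \<mu>) * ?z2 - ((2 * (?\<kappa> + 1) + \<mu>) * s * ?z1 - (?\<kappa> + 1) * r * ?z0))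
      + (2 * (?\<kappa> + 1) + \<mu>) * s * ((r - s\<^sup>2) * ?zs1 - (?\<kappa> + 1) * (r * ?z0 - s * ?z1))
      - (?\<kappa> + 1) * r * ((r - s\<^sup>2) * ?zs0 - (?\<kappa> + \<mu>) * (s * ?z0 - ?z1))"
    by (simp add: power2_eq_square algebra_simps)
  also have "\<dots> = 0"
    by (simp only: zonal_recurrences[OF assms] IH)
  finally have 1: "(r - s\<^sup>2) * ?zs2 = (?\<kappa> + 2) * (r * ?z1 - s * ?z2)"
    using assms by simp
  have "(?\<kappa> + 2) * r * ?zs1 - (?\<kappa> + 1 + \<mu>) * (s * ?zs2 - (?\<kappa> + 2) * ?z2)
      = (?\<kappa> + 2) * ((?\<kappa> + 1 + \<mu>) * ?z2 - ((2 * (?\<kappa> + 1) + \<mu>) * s * ?z1 - (?\<kappa> + 1) * r * ?z0))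
      - s * ((?\<kappa> + 1 + \<mu>) * ?zs2 - ((2 * (?\<kappa> + 1) + \<mu>) * (?z1 + s * ?zs1) - (?\<kappa> + 1) * r * ?zs0))
      + s * ((?\<kappa> + 1) * r * ?zs0 - (?\<kappa> + \<mu>) * (s * ?zs1 - (?\<kappa> + 1) * ?z1))
      + (?\<kappa> + 2) * ((r - s\<^sup>2) * ?zs1 - (?\<kappa> + 1) * (r * ?z0 - s * ?z1))"
    by (simp add: power2_eq_square algebra_simps)
  also have "\<dots> = 0"
    by (simp only: zonal_recurrences[OF assms] IH)
  finally have 2: "(?\<kappa> + 2) * r * ?zs1 = (?\<kappa> + 1 + \<mu>) * (s * ?zs2 - (?\<kappa> + 2) * ?z2)"
    by simp
  have "(r - s\<^sup>2) * ?zs1 - (?\<kappa> + 1 + \<mu>) * (s * ?z1 - ?z2)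
      = ((?\<kappa> + 1 + \<mu>) * ?z2 - ((2 * (?\<kappa> + 1) + \<mu>) * s * ?z1 - (?\<kappa> + 1) * r * ?z0))
      + ((r - s\<^sup>2) * ?zs1 - (?\<kappa> + 1) * (r * ?z0 - s * ?z1))"
    by (simp add: power2_eq_square algebra_simps)
  also have "\<dots> = 0"
    by (simp only: zonal_recurrences[OF assms] IH)
  finally have 3: "(r - s\<^sup>2) * ?zs1 = (?\<kappa> + 1 + \<mu>) * (s * ?z1 - ?z2)"
    by simp
  have "real (Suc k) = ?\<kappa> + 1" "real (Suc k) + 1 = ?\<kappa> + 2"
    by simp_all
  then show ?case
    using 1 2 3 by (simp only: simp_thms)
qed (simp add: power2_eq_square)

lemma zonal_raising:
  assumes "\<mu> \<ge> 0"
  shows "(r - s\<^sup>2) * zonal_s \<mu> k s r = (real k + \<mu>) * (s * zonal \<mu> k s r - zonal \<mu> (Suc k) s r)"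
  using zonal_ladder[OF assms] by blast

text \<open>The Gegenbauer differential equation, which expresses that the zonal function is harmonic. It
  results from differentiating the raising relation and eliminating the derivative of degree
  \<open>k + 1\<close> with the recurrence and the ladder.\<close>

lemma zonal_ODE:
  assumes "\<mu> \<ge> 0"
  shows "(r - s\<^sup>2) * zonal_ss \<mu> k s r = (\<mu> + 1) * s * zonal_s \<mu> k s r - real k * (real k + \<mu>) * zonal \<mu> k s r"
proof -
  have "((\<lambda>s. (r - s\<^sup>2) * zonal_s \<mu> k s r) has_real_derivative
          (r - s\<^sup>2) * zonal_ss \<mu> k s r - 2 * s * zonal_s \<mu> k s r) (at s)"
    by (rule derivative_eq_intros DERIV_zonal_s refl | simp)+
  moreover have "((\<lambda>s. (real k + \<mu>) * (s * zonal \<mu> k s r - zonal \<mu> (Suc k) s r)) has_real_derivative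
      (real k + \<mu>) * (zonal \<mu> k s r + s * zonal_s \<mu> k s r - zonal_s \<mu> (Suc k) s r)) (at s)"
    by (rule derivative_eq_intros DERIV_zonal refl | simp)+
  ultimately have "(r - s\<^sup>2) * zonal_ss \<mu> k s r - 2 * s * zonal_s \<mu> k s r =
      (real k + \<mu>) * (zonal \<mu> k s r + s * zonal_s \<mu> k s r - zonal_s \<mu> (Suc k) s r)"
    unfolding zonal_raising[OF assms] by (rule DERIV_unique)
  moreover have "(real k + \<mu>) * zonal_s \<mu> (Suc k) s r
      = (real k + 1) * s * zonal_s \<mu> k s r + (real k + 1) * (real k + \<mu>) * zonal \<mu> k s r"
  proof (cases k)
    case (Suc l)
    then show ?thesis
      using zonal_recurrences(2)[OF assms, of l s r] zonal_ladder[OF assms, of r s l]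
      by (simp add: algebra_simps)
  qed simp
  ultimately show ?thesis
    by (simp add: algebra_simps)
qed

text \<open>The left-hand side is what becomes of \<open>\<Sum>\<^sub>b A\<^sub>b\<^sup>x A\<^sub>b\<^sup>y K\<close> for the zonal kernel \<open>K\<close> of degree
  \<open>k\<close> and \<open>A\<^sub>b = x\<^sub>b - \<alpha> \<bar>x\<bar>\<^sup>2 \<partial>\<^sub>b\<close>, when \<open>b\<close> runs through an orthonormal basis of a space of
  dimension \<open>\<mu> + 2\<close>. The value of \<open>\<alpha>\<close> is the one for which \<open>A\<^sub>b\<close> maps harmonic polynomials of
  degree \<open>k\<close> to harmonic polynomials of degree \<open>k + 1\<close>: it sends \<open>h\<close> to the harmonic part of
  \<open>x\<^sub>b h\<close>. The result is invariant under rotations and harmonic in both arguments, hence has to be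
  a multiple of the next zonal kernel; Euler's identities, the differential equation and the
  raising relation confirm this and give the factor.\<close>

lemma zonal_raising_contraction:
  assumes "\<mu> \<ge> 0" "2 * real k + \<mu> > 0" and \<alpha>: "\<alpha> = 1 / (2 * real k + \<mu>)"
  shows "s * zonal \<mu> k s r - 2 * \<alpha> * r * (zonal_s \<mu> k s r + 2 * s * zonal_r \<mu> k s r)
     + \<alpha>\<^sup>2 * r * ((\<mu> + 2) * zonal_s \<mu> k s r + s * zonal_ss \<mu> k s r + 4 * r * zonal_sr \<mu> k s r
           + 4 * s * zonal_r \<mu> k s r + 4 * s * r * zonal_rr \<mu> k s r)
    = \<alpha> * (real k + \<mu>) * zonal \<mu> (Suc k) s r"
proof -
  let ?\<kappa> = "real k" and ?z = "zonal \<mu> k s r" and ?z' = "zonal \<mu> (Suc k) s r"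
    and ?zs = "zonal_s \<mu> k s r" and ?zr = "zonal_r \<mu> k s r" and ?zss = "zonal_ss \<mu> k s r"
    and ?zsr = "zonal_sr \<mu> k s r" and ?zrr = "zonal_rr \<mu> k s r"
  have *: "\<alpha> * (2 * ?\<kappa> + \<mu>) - 1 = 0" "s * ?zs + 2 * r * ?zr - ?\<kappa> * ?z = 0"
    "s * ?zss + 2 * r * ?zsr - (?\<kappa> - 1) * ?zs = 0" "s * ?zsr + 2 * r * ?zrr - (?\<kappa> - 2) * ?zr = 0"
    "(r - s\<^sup>2) * ?zs - (?\<kappa> + \<mu>) * (s * ?z - ?z') = 0"
    "(r - s\<^sup>2) * ?zss - ((\<mu> + 1) * s * ?zs - ?\<kappa> * (?\<kappa> + \<mu>) * ?z) = 0"
    using assms zonal_Euler[OF assms(1), of s k r] zonal_s_Euler[OF assms(1), of s k r]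
      zonal_r_Euler[OF assms(1), of s k r] zonal_raising[OF assms(1), of r s k]
      zonal_ODE[OF assms(1), of r s k] by simp_all
  \<comment> \<open>Euler's identities remove the derivatives in \<open>r\<close>, the differential equation removes the
    second derivative in \<open>s\<close>, and the raising relation the first.\<close>
  have "s * ?z - 2 * \<alpha> * r * (?zs + 2 * s * ?zr)
     + \<alpha>\<^sup>2 * r * ((\<mu> + 2) * ?zs + s * ?zss + 4 * r * ?zsr + 4 * s * ?zr + 4 * s * r * ?zrr)
     - \<alpha> * (?\<kappa> + \<mu>) * ?z'
    = - \<alpha> * ((r - s\<^sup>2) * ?zs - (?\<kappa> + \<mu>) * (s * ?z - ?z'))
      + (\<alpha> * ((r - s\<^sup>2) * ?zs + ?\<kappa> * s * ?z) - s * ?z) * (\<alpha> * (2 * ?\<kappa> + \<mu>) - 1)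
      + (\<alpha>\<^sup>2 * s * ?\<kappa> - 2 * \<alpha> * s) * (s * ?zs + 2 * r * ?zr - ?\<kappa> * ?z)
      + \<alpha>\<^sup>2 * (2 * r - s\<^sup>2) * (s * ?zss + 2 * r * ?zsr - (?\<kappa> - 1) * ?zs)
      + \<alpha>\<^sup>2 * 2 * s * r * (s * ?zsr + 2 * r * ?zrr - (?\<kappa> - 2) * ?zr)
      - \<alpha>\<^sup>2 * s * ((r - s\<^sup>2) * ?zss - ((\<mu> + 1) * s * ?zs - ?\<kappa> * (?\<kappa> + \<mu>) * ?z))"
    by (simp add: power2_eq_square algebra_simps)
  also have "\<dots> = 0"
    by (simp only: *)
  finally show ?thesis by simp
qed


section \<open>Sums of products of polynomial functions\<close>

lemma real_polynomial_function_directional_derivative: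
  assumes "real_polynomial_function f"
  shows "\<exists>f'. real_polynomial_function f' \<and>
           (\<forall>x. ((\<lambda>h. f (x + h *\<^sub>R b)) has_real_derivative f' x) (at 0))"
  using assms
proof induction
  case (linear f)
  have "f (x + h *\<^sub>R b) = f x + h * f b" for x h
    using linear by (simp add: linear_simps)
  then have "((\<lambda>h. f (x + h *\<^sub>R b)) has_real_derivative f b) (at 0)" for x
    by (auto intro!: derivative_eq_intros)
  then show ?case
    by (intro exI[of _ "\<lambda>_. f b"]) auto
next
  case (const c)
  show ?case by (intro exI[of _ "\<lambda>_. 0"]) auto
next
  case (add f g)
  then obtain f' g' where "real_polynomial_function f'" "real_polynomial_function g'"
    "\<And>x. ((\<lambda>h. f (x + h *\<^sub>R b)) has_real_derivative f' x) (at 0)"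
    "\<And>x. ((\<lambda>h. g (x + h *\<^sub>R b)) has_real_derivative g' x) (at 0)" by blast
  then show ?case
    by (intro exI[of _ "\<lambda>x. f' x + g' x"]) (auto intro!: derivative_intros)
next
  case (mult f g)
  then obtain f' g' where D: "real_polynomial_function f'" "real_polynomial_function g'"
    "\<And>x. ((\<lambda>h. f (x + h *\<^sub>R b)) has_real_derivative f' x) (at 0)"
    "\<And>x. ((\<lambda>h. g (x + h *\<^sub>R b)) has_real_derivative g' x) (at 0)" by blast
  have "((\<lambda>h. f (x + h *\<^sub>R b) * g (x + h *\<^sub>R b)) has_real_derivative f' x * g x + g' x * f x) (at 0)" for x
    using DERIV_mult[OF D(3,4)[of x]] by simp
  then show ?case using D(1,2) mult.hyps
    by (intro exI[of _ "\<lambda>x. f' x * g x + g' x * f x"]) auto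
qed

text \<open>Kernels that are positive semidefinite on \<open>V\<close> for the explicit reason that they are finite sums
  \<open>\<Sum>\<^sub>i \<phi>\<^sub>i(x) \<phi>\<^sub>i(y)\<close>. The \<open>\<phi>\<^sub>i\<close> are required to be polynomial functions so that they can be
  differentiated any number of times.\<close>

definition gram_kernel :: "'a::real_normed_vector set \<Rightarrow> ('a \<Rightarrow> 'a \<Rightarrow> real) \<Rightarrow> bool" where
  "gram_kernel V K \<longleftrightarrow> (\<exists>(N::nat) \<phi>. (\<forall>i<N. real_polynomial_function (\<phi> i)) \<and>
     (\<forall>x\<in>V. \<forall>y\<in>V. K x y = (\<Sum>i<N. \<phi> i x * \<phi> i y)))"

lemma gram_kernelI:
  assumes "finite I" "\<And>i. i \<in> I \<Longrightarrow> real_polynomial_function (\<phi> i)"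
    and "\<And>x y. x \<in> V \<Longrightarrow> y \<in> V \<Longrightarrow> K x y = (\<Sum>i\<in>I. \<phi> i x * \<phi> i y)"
  shows "gram_kernel V K"
proof -
  obtain g where g: "bij_betw g {0..<card I} I"
    using ex_bij_betw_nat_finite[OF assms(1)] by blast
  show ?thesis
    unfolding gram_kernel_def
  proof (intro exI[of _ "card I"] exI[of _ "\<phi> \<circ> g"] conjI allI impI ballI)
    fix i assume "i < card I"
    then show "real_polynomial_function ((\<phi> \<circ> g) i)"
      using g by (auto simp: bij_betw_def intro!: assms(2))
  next
    fix x y assume "x \<in> V" "y \<in> V"
    then show "K x y = (\<Sum>i<card I. (\<phi> \<circ> g) i x * (\<phi> \<circ> g) i y)"
      using sum.reindex_bij_betw[OF g, of "\<lambda>i. \<phi> i x * \<phi> i y"] assms(3)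
      by (simp add: atLeast0LessThan)
  qed
qed

text \<open>Applying one and the same linear operator \<open>A\<close> in both variables turns \<open>\<Sum>\<^sub>i \<phi>\<^sub>i(x) \<phi>\<^sub>i(y)\<close> into
  \<open>\<Sum>\<^sub>i (A \<phi>\<^sub>i)(x) (A \<phi>\<^sub>i)(y)\<close>, again a sum of this kind. Here \<open>A = x\<^sub>b - \<alpha> \<bar>x\<bar>\<^sup>2 \<partial>\<^sub>b\<close>, and the
  kernels obtained are added up over \<open>b\<close>. The conclusion is phrased by derivatives of the kernel
  alone, so that it can be evaluated on a closed formula for \<open>K\<close>. Being a sum
  \<open>\<Sum>\<^sub>i \<phi>\<^sub>i(x) \<phi>\<^sub>i(y)\<close>, the kernel is symmetric, and its derivative in the second argument is \<open>K1\<close>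
  with \<open>x\<close> and \<open>y\<close> exchanged.\<close>

lemma gram_kernel_raise:
  fixes V :: "'a::euclidean_space set"
  assumes "gram_kernel V K" "subspace V" "B \<subseteq> V" "finite B"
    and K1: "\<And>b x y. b \<in> B \<Longrightarrow> x \<in> V \<Longrightarrow> y \<in> V \<Longrightarrow>
      ((\<lambda>h. K (x + h *\<^sub>R b) y) has_real_derivative K1 b x y) (at 0)"
    and K2: "\<And>b x y. b \<in> B \<Longrightarrow> x \<in> V \<Longrightarrow> y \<in> V \<Longrightarrow>
      ((\<lambda>h. K1 b x (y + h *\<^sub>R b)) has_real_derivative K2 b x y) (at 0)"
  shows "gram_kernel V (\<lambda>x y. \<Sum>b\<in>B. inner x b * inner y b * K x y
           - \<alpha> * inner x x * inner y b * K1 b x y - \<alpha> * inner y y * inner x b * K1 b y x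
           + \<alpha>\<^sup>2 * inner x x * inner y y * K2 b x y)"
proof -
  obtain N :: nat and \<phi> where \<phi>: "\<And>i. i < N \<Longrightarrow> real_polynomial_function (\<phi> i)"
    and K: "\<And>x y. x \<in> V \<Longrightarrow> y \<in> V \<Longrightarrow> K x y = (\<Sum>i<N. \<phi> i x * \<phi> i y)"
    using assms(1) unfolding gram_kernel_def by blast
  have "\<forall>i b. \<exists>f'. i < N \<longrightarrow> real_polynomial_function f' \<and>
           (\<forall>x. ((\<lambda>h. \<phi> i (x + h *\<^sub>R b)) has_real_derivative f' x) (at 0))"
    using \<phi> real_polynomial_function_directional_derivative by blast
  then obtain D where D: "\<And>i b. i < N \<Longrightarrow> real_polynomial_function (D i b)"
    "\<And>i b x. i < N \<Longrightarrow> ((\<lambda>h. \<phi> i (x + h *\<^sub>R b)) has_real_derivative D i b x) (at 0)"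
    by metis
  have shift: "x + h *\<^sub>R b \<in> V" if "x \<in> V" "b \<in> B" for x b h
    using that assms by (auto intro: subspace_add subspace_scale)
  have K1': "K1 b x y = (\<Sum>i<N. D i b x * \<phi> i y)" if "b \<in> B" "x \<in> V" "y \<in> V" for b x y
  proof (rule DERIV_unique)
    show "((\<lambda>h. K (x + h *\<^sub>R b) y) has_real_derivative K1 b x y) (at 0)"
      by (rule K1) fact+
    show "((\<lambda>h. K (x + h *\<^sub>R b) y) has_real_derivative (\<Sum>i<N. D i b x * \<phi> i y)) (at 0)"
      using that by (simp add: K shift) (auto intro!: DERIV_sum DERIV_cmult_right D)
  qed
  have K2': "K2 b x y = (\<Sum>i<N. D i b x * D i b y)" if "b \<in> B" "x \<in> V" "y \<in> V" for b x y
  proof (rule DERIV_unique)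
    show "((\<lambda>h. K1 b x (y + h *\<^sub>R b)) has_real_derivative K2 b x y) (at 0)"
      by (rule K2) fact+
    show "((\<lambda>h. K1 b x (y + h *\<^sub>R b)) has_real_derivative (\<Sum>i<N. D i b x * D i b y)) (at 0)"
      using that by (simp add: K1' shift) (auto intro!: DERIV_sum DERIV_cmult D)
  qed
  have poly_inner: "real_polynomial_function (\<lambda>x. inner x b)" for b :: 'a
    by (intro real_polynomial_function.intros(1) bounded_linear_inner_left)
  have "real_polynomial_function (\<lambda>x::'a. inner x x)"
    unfolding euclidean_inner[of x x for x] using poly_inner
    by (intro real_polynomial_function_sum) auto
  with \<phi> D(1) poly_inner have poly:
    "real_polynomial_function (\<lambda>x. inner x b * \<phi> i x - \<alpha> * inner x x * D i b x)" if "i < N" for i b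
    using that by (intro real_polynomial_function_diff real_polynomial_function.intros(2,4)) auto
  show ?thesis
  proof (rule gram_kernelI)
    show "finite (B \<times> {..<N})" using assms by simp
    show "real_polynomial_function (case bi of (b, i) \<Rightarrow> \<lambda>x. inner x b * \<phi> i x - \<alpha> * inner x x * D i b x)"
      if "bi \<in> B \<times> {..<N}" for bi
      using that poly by auto
    fix x y assume xy: "x \<in> V" "y \<in> V"
    have "(\<Sum>b\<in>B. inner x b * inner y b * K x y
           - \<alpha> * inner x x * inner y b * K1 b x y - \<alpha> * inner y y * inner x b * K1 b y x
           + \<alpha>\<^sup>2 * inner x x * inner y y * K2 b x y)
      = (\<Sum>b\<in>B. \<Sum>i<N. (inner x b * \<phi> i x - \<alpha> * inner x x * D i b x) *
                        (inner y b * \<phi> i y - \<alpha> * inner y y * D i b y))"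
    proof (intro sum.cong refl)
      fix b assume "b \<in> B"
      then show "inner x b * inner y b * K x y
           - \<alpha> * inner x x * inner y b * K1 b x y - \<alpha> * inner y y * inner x b * K1 b y x
           + \<alpha>\<^sup>2 * inner x x * inner y y * K2 b x y
         = (\<Sum>i<N. (inner x b * \<phi> i x - \<alpha> * inner x x * D i b x) *
                        (inner y b * \<phi> i y - \<alpha> * inner y y * D i b y))"
        using xy by (simp only: K K1' K2' sum_distrib_left sum.distrib[symmetric] sum_subtractf[symmetric])
          (intro sum.cong refl, simp add: power2_eq_square algebra_simps)
    qed
    then show "(\<Sum>b\<in>B. inner x b * inner y b * K x y
           - \<alpha> * inner x x * inner y b * K1 b x y - \<alpha> * inner y y * inner x b * K1 b y x
           + \<alpha>\<^sup>2 * inner x x * inner y y * K2 b x y)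
       = (\<Sum>bi\<in>B \<times> {..<N}. (case bi of (b, i) \<Rightarrow> \<lambda>x. inner x b * \<phi> i x - \<alpha> * inner x x * D i b x) x *
            (case bi of (b, i) \<Rightarrow> \<lambda>x. inner x b * \<phi> i x - \<alpha> * inner x x * D i b x) y)"
      by (simp add: sum.cartesian_product case_prod_unfold)
  qed
qed

lemma gram_kernel_scale:
  assumes "gram_kernel V K" "c \<ge> 0"
  shows "gram_kernel V (\<lambda>x y. c * K x y)"
proof -
  obtain N :: nat and \<phi> where "\<And>i. i < N \<Longrightarrow> real_polynomial_function (\<phi> i)"
    and "\<And>x y. x \<in> V \<Longrightarrow> y \<in> V \<Longrightarrow> K x y = (\<Sum>i<N. \<phi> i x * \<phi> i y)"
    using assms(1) unfolding gram_kernel_def by blast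
  moreover have "c * (a * b) = (sqrt c * a) * (sqrt c * b)" for a b
  proof -
    have "(sqrt c * a) * (sqrt c * b) = (sqrt c * sqrt c) * (a * b)"
      by (simp only: mult_ac)
    then show ?thesis using assms(2) by simp
  qed
  ultimately show ?thesis
    by (intro gram_kernelI[where I = "{..<N}" and \<phi> = "\<lambda>i x. sqrt c * \<phi> i x"])
       (auto simp only: sum_distrib_left lessThan_iff finite_lessThan intro: real_polynomial_function.intros(2,4))
qed

section \<open>Positive semidefiniteness of zonal kernels\<close>

text \<open>Schoenberg's theorem in the form needed here: the kernel of degree \<open>k + 1\<close> is, up to a positive
  factor, obtained from that of degree \<open>k\<close> by the raising operators. The span of an orthonormal
  set is used in place of a type of the right dimension, because the kernel will be needed on
  a hyperplane of the ambient space.\<close>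

lemma gram_kernel_zonal:
  fixes B :: "'a::euclidean_space set"
  assumes "pairwise orthogonal B" "\<And>b. b \<in> B \<Longrightarrow> norm b = 1" "card B \<ge> 2"
    and \<mu>: "\<mu> = real (card B) - 2"
  shows "gram_kernel (span B) (\<lambda>x y. zonal \<mu> k (inner x y) (inner x x * inner y y))"
proof (induction k)
  case 0
  show ?case
    by (rule gram_kernelI[where I = "{()}" and \<phi> = "\<lambda>_ _. 1"]) auto
next
  case (Suc k)
  have fin: "finite B" using assms(3) by (metis card.infinite not_numeral_le_zero)
  have mu0: "\<mu> \<ge> 0" using assms by simp
  have Parseval: "(\<Sum>b\<in>B. inner x b * inner y b) = inner x y" if "x \<in> span B" for x y
  proof -
    have "(\<Sum>b\<in>B. inner x b * inner y b) = inner (\<Sum>b\<in>B. inner x b *\<^sub>R b) y"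
      by (simp add: inner_sum_left inner_commute[of y])
    then show ?thesis
      using orthonormal_basis_expand[OF assms(1,2) that fin] by simp
  qed
  show ?case
  proof (cases "k = 0")
    case True
    \<comment> \<open>For \<open>k = 0\<close> and \<open>\<mu> = 0\<close> the constant \<open>\<alpha>\<close> below is undefined.\<close>
    show ?thesis
    proof (rule gram_kernelI[where I = B and \<phi> = "\<lambda>b x. inner x b"])
      show "real_polynomial_function (\<lambda>x. inner x b)" for b :: 'a
        by (intro real_polynomial_function.intros(1) bounded_linear_inner_left)
    qed (use True fin Parseval in auto)
  next
    case False
    define \<alpha> where "\<alpha> = 1 / (2 * real k + \<mu>)"
    define Z where "Z f x y = f \<mu> k (inner x y) (inner x x * inner y y)"
      for f :: "real \<Rightarrow> nat \<Rightarrow> real \<Rightarrow> real \<Rightarrow> real" and x y :: 'a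
    define K1 where "K1 b x y = Z zonal_s x y * inner y b + Z zonal_r x y * (2 * inner x b * inner y y)" for b x y
    define K2 where "K2 b x y = Z zonal_s x y
       + inner y b * (Z zonal_ss x y * inner x b + Z zonal_sr x y * (inner x x * (2 * inner y b)))
       + Z zonal_r x y * (4 * inner x b * inner y b)
       + 2 * inner x b * inner y y * (Z zonal_sr x y * inner x b + Z zonal_rr x y * (inner x x * (2 * inner y b)))"
      for b x y
    have D_inner: "((\<lambda>h. inner (x + h *\<^sub>R b) y) has_real_derivative inner y b) (at 0)"
      "((\<lambda>h. inner y (x + h *\<^sub>R b)) has_real_derivative inner y b) (at 0)"
      "((\<lambda>h. inner (x + h *\<^sub>R b) (x + h *\<^sub>R b)) has_real_derivative 2 * inner x b) (at 0)" for x y b :: 'a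
      by (auto simp: inner_add inner_commute intro!: derivative_eq_intros)
    have DK1: "((\<lambda>h. Z zonal (x + h *\<^sub>R b) y) has_real_derivative K1 b x y) (at 0)" for b x y
      unfolding Z_def K1_def
      by (rule DERIV_cong, rule DERIV_zonal, rule D_inner, rule DERIV_cmult_right, rule D_inner) simp
    have DK2: "((\<lambda>h. K1 b x (y + h *\<^sub>R b)) has_real_derivative K2 b x y) (at 0)" if "b \<in> B" for b x y
    proof -
      have bb: "inner b b = 1" using assms(2)[OF that] by (simp add: norm_eq_1)
      show ?thesis
        unfolding Z_def K1_def K2_def
        by (rule DERIV_cong, (rule DERIV_add DERIV_mult DERIV_cmult DERIV_zonal_s DERIV_zonal_r D_inner)+)
           (simp add: bb algebra_simps)
    qed
    have "gram_kernel (span B) (\<lambda>x y. 1 / (\<alpha> * (real k + \<mu>)) * (\<Sum>b\<in>B. inner x b * inner y b * Z zonal x y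
           - \<alpha> * inner x x * inner y b * K1 b x y - \<alpha> * inner y y * inner x b * K1 b y x
           + \<alpha>\<^sup>2 * inner x x * inner y y * K2 b x y))"
      by (intro gram_kernel_scale gram_kernel_raise DK1 DK2 fin subspace_span span_superset)
         (use Suc mu0 in \<open>simp_all add: Z_def \<alpha>_def\<close>)
    moreover have "1 / (\<alpha> * (real k + \<mu>)) * (\<Sum>b\<in>B. inner x b * inner y b * Z zonal x y
           - \<alpha> * inner x x * inner y b * K1 b x y - \<alpha> * inner y y * inner x b * K1 b y x
           + \<alpha>\<^sup>2 * inner x x * inner y y * K2 b x y) = Z (\<lambda>\<mu> k. zonal \<mu> (Suc k)) x y"
      if "x \<in> span B" "y \<in> span B" for x y
    proof -
      define p q s where "p = inner x x" "q = inner y y" "s = inner x y"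
      have Z_sym: "Z f y x = Z f x y" for f
        by (simp add: Z_def inner_commute mult.commute)
      have "(\<Sum>b\<in>B. inner x b * inner y b * Z zonal x y
           - \<alpha> * p * inner y b * K1 b x y - \<alpha> * q * inner x b * K1 b y x
           + \<alpha>\<^sup>2 * p * q * K2 b x y)
        = (\<Sum>b\<in>B. (Z zonal x y - 4 * \<alpha> * (p * q) * Z zonal_r x y
                 + \<alpha>\<^sup>2 * (p * q) * (Z zonal_ss x y + 4 * Z zonal_r x y + 4 * (p * q) * Z zonal_rr x y)) * (inner x b * inner y b)
               + (\<alpha>\<^sup>2 * p * q * 2 * q * Z zonal_sr x y - \<alpha> * q * Z zonal_s x y) * (inner x b * inner x b)
               + (\<alpha>\<^sup>2 * p * q * 2 * p * Z zonal_sr x y - \<alpha> * p * Z zonal_s x y) * (inner y b * inner y b)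
               + \<alpha>\<^sup>2 * p * q * Z zonal_s x y)"
        unfolding K1_def K2_def Z_sym p_q_s_def[symmetric]
        by (intro sum.cong refl) (simp add: power2_eq_square algebra_simps)
      also have "\<dots> = (Z zonal x y - 4 * \<alpha> * (p * q) * Z zonal_r x y
                 + \<alpha>\<^sup>2 * (p * q) * (Z zonal_ss x y + 4 * Z zonal_r x y + 4 * (p * q) * Z zonal_rr x y)) * s
               + (\<alpha>\<^sup>2 * p * q * 2 * q * Z zonal_sr x y - \<alpha> * q * Z zonal_s x y) * p
               + (\<alpha>\<^sup>2 * p * q * 2 * p * Z zonal_sr x y - \<alpha> * p * Z zonal_s x y) * q
               + (\<mu> + 2) * (\<alpha>\<^sup>2 * p * q * Z zonal_s x y)"
        unfolding sum.distrib sum_distrib_left[symmetric] using that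
        by (simp add: Parseval p_q_s_def \<mu>)
      also have "\<dots> = s * Z zonal x y - 2 * \<alpha> * (p * q) * (Z zonal_s x y + 2 * s * Z zonal_r x y)
         + \<alpha>\<^sup>2 * (p * q) * ((\<mu> + 2) * Z zonal_s x y + s * Z zonal_ss x y + 4 * (p * q) * Z zonal_sr x y
           + 4 * s * Z zonal_r x y + 4 * s * (p * q) * Z zonal_rr x y)"
        by (simp add: power2_eq_square algebra_simps)
      also have "\<dots> = \<alpha> * (real k + \<mu>) * Z (\<lambda>\<mu> k. zonal \<mu> (Suc k)) x y"
        unfolding Z_def p_q_s_def
        by (rule zonal_raising_contraction) (use mu0 False in \<open>auto simp: \<alpha>_def\<close>)
      finally show ?thesis
        using mu0 False by (simp add: p_q_s_def \<alpha>_def)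
    qed
    ultimately show ?thesis
      by (simp add: gram_kernel_def Z_def)
  qed
qed


section \<open>The polynomials Q as zonal kernels\<close>

text \<open>The classical recurrence after division by the values at \<open>1\<close>, whose successive ratios are
  \<open>(k + \<mu>) / (k + 1)\<close>; the Chebyshev recurrence is its instance \<open>\<mu> = 0\<close>.\<close>

lemma coeff_gegen_P_recurrence:
  assumes "m \<ge> 2" and \<mu>: "\<mu> = real m - 2"
  shows "(real k + 1 + \<mu>) * coeff (gegen_P m (Suc (Suc k))) j =
    (2 * (real k + 1) + \<mu>) * coeff (pCons 0 (gegen_P m (Suc k))) j - (real k + 1) * coeff (gegen_P m k) j"
proof (cases "m = 2")
  case True
  have "chebyshev_T (Suc (Suc k)) = smult 2 (pCons 0 (chebyshev_T (Suc k))) - chebyshev_T k"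
    by simp
  then have "coeff (chebyshev_T (Suc (Suc k))) j
      = 2 * coeff (pCons 0 (chebyshev_T (Suc k))) j - coeff (chebyshev_T k) j"
    by (simp only: coeff_diff coeff_smult)
  then show ?thesis
    using True by (simp only: gegen_P_def \<mu> if_True) (simp add: algebra_simps)
next
  case False
  define a where "a = real m / 2 - 1"
  have a: "\<mu> = 2 * a" "a > 0"
    using assms False by (auto simp: a_def)
  define \<gamma> where "\<gamma> k = poly (gegenbauer a k) 1" for k
  have \<gamma>_pos: "\<gamma> k > 0" for k
    using a by (simp add: \<gamma>_def poly_gegenbauer_1 pochhammer_pos)
  have \<gamma>_Suc: "(real k + 1) * \<gamma> (Suc k) = (real k + \<mu>) * \<gamma> k" for k
    by (simp add: \<gamma>_def poly_gegenbauer_1 pochhammer_Suc a divide_simps) (simp add: algebra_simps)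
  have P: "gegen_P m k = smult (1 / \<gamma> k) (gegenbauer a k)" for k
    using False by (simp add: gegen_P_def Let_def a_def \<gamma>_def)
  have P': "pCons 0 (gegen_P m k) = smult (1 / \<gamma> k) (pCons 0 (gegenbauer a k))" for k
    by (simp add: P)
  define x0 x1 x2 where "x0 = coeff (gegenbauer a k) j" "x1 = coeff (pCons 0 (gegenbauer a (Suc k))) j"
    "x2 = coeff (gegenbauer a (Suc (Suc k))) j"
  have "smult (real k + 2) (gegenbauer a (Suc (Suc k)))
      = smult (2 * (real k + 1 + a)) (pCons 0 (gegenbauer a (Suc k))) - smult (real k + 2 * a) (gegenbauer a k)"
    by simp
  then have C: "(real k + 2) * x2 = (2 * (real k + 1) + \<mu>) * x1 - (real k + \<mu>) * x0"
    unfolding x0_x1_x2_def by (metis a(1) coeff_diff coeff_smult distrib_left add.assoc)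
  have g2: "(real k + 1 + \<mu>) / \<gamma> (Suc (Suc k)) = (real k + 2) / \<gamma> (Suc k)"
    using \<gamma>_Suc[of "Suc k"] \<gamma>_pos[of "Suc k"] \<gamma>_pos[of "Suc (Suc k)"] by (simp add: field_simps)
  have g1: "(real k + \<mu>) / \<gamma> (Suc k) = (real k + 1) / \<gamma> k"
    using \<gamma>_Suc[of k] \<gamma>_pos[of k] \<gamma>_pos[of "Suc k"] by (simp add: field_simps)
  have "(real k + 1 + \<mu>) * (1 / \<gamma> (Suc (Suc k)) * x2) = (real k + 1 + \<mu>) / \<gamma> (Suc (Suc k)) * x2"
    by simp
  also have "\<dots> = ((real k + 2) * x2) / \<gamma> (Suc k)"
    by (simp only: g2) simp
  also have "\<dots> = (2 * (real k + 1) + \<mu>) * (1 / \<gamma> (Suc k) * x1) - (real k + \<mu>) / \<gamma> (Suc k) * x0"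
    unfolding C by (simp add: diff_divide_distrib)
  also have "\<dots> = (2 * (real k + 1) + \<mu>) * (1 / \<gamma> (Suc k) * x1) - (real k + 1) * (1 / \<gamma> k * x0)"
    by (simp only: g1) simp
  finally show ?thesis
    unfolding P' by (simp only: P coeff_smult x0_x1_x2_def)
qed

text \<open>Both sides satisfy the same recurrence. In the coefficient formula for \<open>Q\<close>, multiplication of
  the Gegenbauer polynomial by its variable becomes a factor \<open>s\<close>, and regarding a polynomial of
  degree \<open>k\<close> as one of degree \<open>k + 2\<close> becomes a factor \<open>r\<close>.\<close>

lemma Q_poly_eq_zonal:
  assumes "m \<ge> 2"
  shows "Q_poly m k u v t = zonal (real m - 2) k (t - u * v) ((1 - u\<^sup>2) * (1 - v\<^sup>2))"
proof -
  define \<mu> s r where "\<mu> = real m - 2" "s = t - u * v" "r = (1 - u\<^sup>2) * (1 - v\<^sup>2)"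
  have mu0: "\<mu> \<ge> 0" using assms by (simp add: \<mu>_s_r_def)
  define H where "H k = (\<Sum>j\<le>k. coeff (gegen_P m k) j * s ^ j * r ^ ((k - j) div 2))" for k
  have "H k = zonal \<mu> k s r"
  proof (induction k rule: induct_nat_012)
    case 0
    show ?case by (simp add: H_def gegen_P_def)
  next
    case 1
    have "gegen_P m (Suc 0) = [:0, 1:]"
      using assms by (auto simp: gegen_P_def Let_def)
    then show ?case by (simp add: H_def)
  next
    case (ge2 k)
    have shift: "(\<Sum>j\<le>Suc (Suc k). coeff (pCons 0 (gegen_P m (Suc k))) j * s ^ j * r ^ ((Suc (Suc k) - j) div 2))
        = s * H (Suc k)"
      by (subst sum.atMost_Suc_shift) (simp add: H_def sum_distrib_left mult_ac del: sum.atMost_Suc)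
    have "(\<Sum>j\<le>Suc (Suc k). coeff (gegen_P m k) j * s ^ j * r ^ ((Suc (Suc k) - j) div 2))
        = (\<Sum>j\<le>k. coeff (gegen_P m k) j * s ^ j * r ^ ((Suc (Suc k) - j) div 2))"
      using degree_P[of m k] by (simp add: coeff_eq_0)
    also have "\<dots> = (\<Sum>j\<le>k. r * (coeff (gegen_P m k) j * s ^ j * r ^ ((k - j) div 2)))"
      by (intro sum.cong) (auto simp: Suc_diff_le)
    finally have drop: "(\<Sum>j\<le>Suc (Suc k). coeff (gegen_P m k) j * s ^ j * r ^ ((Suc (Suc k) - j) div 2)) = r * H k"
      by (simp add: H_def sum_distrib_left)
    have "(real k + 1 + \<mu>) * H (Suc (Suc k))
        = (\<Sum>j\<le>Suc (Suc k). ((real k + 1 + \<mu>) * coeff (gegen_P m (Suc (Suc k))) j) * s ^ j * r ^ ((Suc (Suc k) - j) div 2))"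
      unfolding H_def sum_distrib_left by (simp only: mult.assoc)
    also have "\<dots> = (2 * (real k + 1) + \<mu>) * (s * H (Suc k)) - (real k + 1) * (r * H k)"
      unfolding shift[symmetric] drop[symmetric] sum_distrib_left sum_subtractf[symmetric]
        coeff_gegen_P_recurrence[OF assms \<mu>_s_r_def(1)]
      by (simp only: left_diff_distrib mult.assoc)
    finally show ?case
      using ge2 mu0 by (simp add: zonal.simps(3) field_simps)
  qed
  then show ?thesis
    by (simp add: Q_poly_def H_def \<mu>_s_r_def)
qed

text \<open>The arguments of \<open>Q\<close> are such that \<open>t - u v\<close>, \<open>1 - u\<^sup>2\<close> and \<open>1 - v\<^sup>2\<close> are the inner products
  of the orthogonal projections of \<open>x\<close> and \<open>y\<close> to the hyperplane orthogonal to \<open>e\<close>. That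
  hyperplane has dimension \<open>n - 1\<close>, the dimension to which the polynomial belongs.\<close>

lemma Q_poly_sum_of_products:
  fixes e :: "real ^ 'n"
  assumes "CARD('n) \<ge> 3" "norm e = 1"
  obtains N :: nat and \<psi> where "\<And>x y. norm x = 1 \<Longrightarrow> norm y = 1 \<Longrightarrow>
    Q_poly (CARD('n) - 1) k (inner e x) (inner e y) (inner x y) = (\<Sum>l<N. \<psi> l x * \<psi> l y)"
proof -
  let ?V = "{x. inner e x = 0}"
  obtain B where B: "pairwise orthogonal B" "\<And>b. b \<in> B \<Longrightarrow> norm b = 1" "card B = dim ?V" "span B = ?V"
    using orthonormal_basis_subspace[OF subspace_hyperplane[of e]] by metis
  have ee: "inner e e = 1" using assms by (simp add: norm_eq_1)
  have "e \<noteq> 0" using assms by auto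
  then have card: "card B = CARD('n) - 1"
    using B(3) by (simp add: dim_hyperplane)
  define w where "w x = x - inner e x *\<^sub>R e" for x
  have wV: "w x \<in> ?V" for x by (simp add: w_def inner_diff ee)
  have ww: "inner (w x) (w y) = inner x y - inner e x * inner e y" for x y
    by (simp add: w_def inner_diff ee inner_commute)
  have "gram_kernel ?V (\<lambda>x y. zonal (real (card B) - 2) k (inner x y) (inner x x * inner y y))"
    using gram_kernel_zonal[OF B(1,2) _ refl, of k] assms(1) unfolding card B(4) by simp
  then obtain N :: nat and \<phi> where K: "\<And>x y. x \<in> ?V \<Longrightarrow> y \<in> ?V \<Longrightarrow>
     zonal (real (card B) - 2) k (inner x y) (inner x x * inner y y) = (\<Sum>l<N. \<phi> l x * \<phi> l y)"
    unfolding gram_kernel_def by blast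
  have "Q_poly (CARD('n) - 1) k (inner e x) (inner e y) (inner x y) = (\<Sum>l<N. \<phi> l (w x) * \<phi> l (w y))"
    if "norm x = 1" "norm y = 1" for x y
    using K[OF wV wV, of x y] assms(1) that
    by (simp add: Q_poly_eq_zonal card ww power2_eq_square norm_eq_1)
  then show ?thesis
    by (rule that[of "\<lambda>l x. \<phi> l (w x)" N])
qed


section \<open>The matrices Y\<close>

lemma mat_inner_eq_sum:
  assumes "A \<in> carrier_mat N N" "M \<in> carrier_mat N N"
  shows "mat_inner A M = (\<Sum>i<N. \<Sum>j<N. A $$ (i, j) * M $$ (i, j))"
  using assms
  by (simp add: mat_inner_def trace_mat_def times_mat_def scalar_prod_def atLeast0LessThan)

lemma psd_sum_nonneg:
  assumes "psd N A"
  shows "0 \<le> (\<Sum>i<N. \<Sum>j<N. A $$ (i, j) * (y i * y j))"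
proof -
  have A: "A \<in> carrier_mat N N"
    using assms by (simp add: psd_def sym_mat_def)
  have "0 \<le> scalar_prod (Matrix.vec N y) (A *\<^sub>v Matrix.vec N y)"
    using assms by (simp add: psd_def)
  also have "\<dots> = (\<Sum>i<N. \<Sum>j<N. A $$ (i, j) * (y i * y j))"
    using A by (simp add: scalar_prod_def atLeast0LessThan sum_distrib_left mult_ac)
  finally show ?thesis .
qed

lemma omega_pos: "m \<ge> 1 \<Longrightarrow> \<omega> m > 0"
  by (simp add: omega_eq Gamma_real_pos)

lemma Ybar_mat_carrier: "Ybar_mat n d k u v t \<in> carrier_mat (d - k + 1) (d - k + 1)"
  by (simp add: Ybar_mat_def Y_mat_def)

text \<open>Since \<open>\<lambda>\<^sub>i\<^sub>j\<close> is a nonnegative constant times \<open>sqrt h\<^sub>i sqrt h\<^sub>j\<close>, the entry \<open>(i, j)\<close> of \<open>Y\<close> has the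
  form \<open>\<kappa> \<Sum>\<^sub>l a\<^sub>i(c) \<psi>\<^sub>l(c) a\<^sub>j(c') \<psi>\<^sub>l(c')\<close>. Summation over all pairs of points therefore turns
  \<open>\<langle>G, Y\<rangle>\<close> into a nonnegative combination of values of the quadratic form of \<open>G\<close>, at the vectors
  \<open>y\<^sup>l\<close> with entries \<open>y\<^sup>l\<^sub>i = \<Sum>\<^sub>c \<psi>\<^sub>l(c) a\<^sub>i(c)\<close>. The symmetrization of \<open>Y\<close> does not change a sum over
  all ordered pairs.\<close>

lemma sum_mat_inner_Ybar_nonneg:
  fixes e :: "real ^ 'n"
  assumes "CARD('n) \<ge> 3" "norm e = 1" "\<And>c. c \<in> C \<Longrightarrow> norm c = 1"
    and G: "psd (d - k + 1) G"
  shows "0 \<le> (\<Sum>c\<in>C. \<Sum>c'\<in>C. mat_inner G (Ybar_mat CARD('n) d k (inner e c) (inner e c') (inner c c')))"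
proof -
  define n where "n = CARD('n)"
  define N where "N = d - k + 1"
  define \<kappa> where "\<kappa> = \<omega> n / \<omega> (n - 1) * (\<omega> (n + 2 * k - 1) / \<omega> (n + 2 * k))"
  have \<kappa>: "\<kappa> \<ge> 0"
    unfolding \<kappa>_def using assms(1)
    by (intro mult_nonneg_nonneg divide_nonneg_nonneg less_imp_le[OF omega_pos]) (auto simp: n_def)
  define a where "a i c = sqrt (real (harm_dim (n + 2 * k) i)) * poly (gegen_P (n + 2 * k) i) (inner e c)"
    for i and c :: "real ^ 'n"
  obtain L :: nat and \<psi> where \<psi>: "\<And>x y. norm x = 1 \<Longrightarrow> norm y = 1 \<Longrightarrow>
    Q_poly (n - 1) k (inner e x) (inner e y) (inner x y) = (\<Sum>l<L. \<psi> l x * \<psi> l y)"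
    using Q_poly_sum_of_products[OF assms(1,2), of k] unfolding n_def by metis
  define T where "T c c' = (\<Sum>i<N. \<Sum>j<N. G $$ (i, j) * (\<kappa> * (a i c * a j c') * (\<Sum>l<L. \<psi> l c * \<psi> l c')))" for c c'
  have Y: "Y_mat n d k (inner e c) (inner e c') (inner c c') $$ (i, j) = \<kappa> * (a i c * a j c') * (\<Sum>l<L. \<psi> l c * \<psi> l c')"
    if "i < N" "j < N" "c \<in> C" "c' \<in> C" for i j c c'
    using that assms(3) by (simp add: Y_mat_def N_def lam_def \<kappa>_def a_def real_sqrt_mult flip: \<psi>)
  have "mat_inner G (Ybar_mat n d k (inner e c) (inner e c') (inner c c')) = 1 / 2 * (T c c' + T c' c)"
    if "c \<in> C" "c' \<in> C" for c c'
  proof -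
    have "mat_inner G (Ybar_mat n d k (inner e c) (inner e c') (inner c c'))
      = (\<Sum>i<N. \<Sum>j<N. G $$ (i, j) * Ybar_mat n d k (inner e c) (inner e c') (inner c c') $$ (i, j))"
      using G unfolding N_def by (intro mat_inner_eq_sum Ybar_mat_carrier) (auto simp: psd_def sym_mat_def)
    also have "\<dots> = (\<Sum>i<N. \<Sum>j<N. 1 / 2 *
        (G $$ (i, j) * (\<kappa> * (a i c * a j c') * (\<Sum>l<L. \<psi> l c * \<psi> l c'))
         + G $$ (i, j) * (\<kappa> * (a i c' * a j c) * (\<Sum>l<L. \<psi> l c' * \<psi> l c))))"
    proof (intro sum.cong refl)
      fix i j assume ij: "i \<in> {..<N}" "j \<in> {..<N}"
      have dims: "Y_mat n d k u v t \<in> carrier_mat N N" for u v t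
        by (simp add: Y_mat_def N_def)
      have "Ybar_mat n d k (inner e c) (inner e c') (inner c c') $$ (i, j)
        = 1 / 2 * (Y_mat n d k (inner e c) (inner e c') (inner c c') $$ (i, j)
            + Y_mat n d k (inner e c') (inner e c) (inner c' c) $$ (i, j))"
        unfolding Ybar_mat_def inner_commute[of c' c]
        using ij dims[of "inner e c" "inner e c'" "inner c c'"] dims[of "inner e c'" "inner e c" "inner c c'"]
        by (subst index_smult_mat) (auto simp: index_add_mat)
      then show "G $$ (i, j) * Ybar_mat n d k (inner e c) (inner e c') (inner c c') $$ (i, j) = 1 / 2 *
        (G $$ (i, j) * (\<kappa> * (a i c * a j c') * (\<Sum>l<L. \<psi> l c * \<psi> l c'))
         + G $$ (i, j) * (\<kappa> * (a i c' * a j c) * (\<Sum>l<L. \<psi> l c' * \<psi> l c)))"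
        using ij that by (simp only: Y lessThan_iff) (simp add: distrib_left)
    qed
    also have "\<dots> = 1 / 2 * (T c c' + T c' c)"
      unfolding T_def by (simp only: sum_distrib_left[symmetric] sum.distrib)
    finally show ?thesis .
  qed
  then have "(\<Sum>c\<in>C. \<Sum>c'\<in>C. mat_inner G (Ybar_mat n d k (inner e c) (inner e c') (inner c c')))
      = 1 / 2 * ((\<Sum>c\<in>C. \<Sum>c'\<in>C. T c c') + (\<Sum>c\<in>C. \<Sum>c'\<in>C. T c' c))"
    by (simp only: sum_distrib_left[symmetric] sum.distrib cong: sum.cong)
  also have "\<dots> = (\<Sum>c\<in>C. \<Sum>c'\<in>C. T c c')"
    by (subst (2) sum.swap) simp
  also have "\<dots> = (\<Sum>c\<in>C. \<Sum>c'\<in>C. \<Sum>i<N. \<Sum>j<N. \<Sum>l<L. \<kappa> * (G $$ (i, j) * ((\<psi> l c * a i c) * (\<psi> l c' * a j c'))))"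
    unfolding T_def sum_distrib_left by (simp only: mult_ac)
  also have "\<dots> = (\<Sum>l<L. \<Sum>i<N. \<Sum>j<N. \<Sum>c\<in>C. \<Sum>c'\<in>C. \<kappa> * (G $$ (i, j) * ((\<psi> l c * a i c) * (\<psi> l c' * a j c'))))"
    unfolding sum.swap[of _ "{..<N}" C] sum.swap[of _ "{..<L}" C] sum.swap[of _ "{..<L}" "{..<N}"] ..
  also have "\<dots> = (\<Sum>l<L. \<kappa> * (\<Sum>i<N. \<Sum>j<N. G $$ (i, j) * ((\<Sum>c\<in>C. \<psi> l c * a i c) * (\<Sum>c\<in>C. \<psi> l c * a j c))))"
    by (simp only: sum_product) (simp only: sum_distrib_left)
  also have "\<dots> \<ge> 0"
    by (rule sum_nonneg, rule mult_nonneg_nonneg[OF \<kappa> psd_sum_nonneg[OF G[folded N_def]]])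
  finally show ?thesis
    by (simp add: n_def)
qed

lemma mat_inner_E0_Ybar:
  assumes "n \<ge> 2"
  shows "mat_inner (E0 d) (Ybar_mat n d 0 u v t) = 1"
proof -
  have P0: "gegen_P m 0 = 1" for m by (simp add: gegen_P_def)
  have "lam n 0 0 0 = 1"
    using assms less_imp_neq[OF omega_pos[of n]] less_imp_neq[OF omega_pos[of "n - 1"]]
    by (simp add: lam_def harm_dim_0)
  then have Y: "Y_mat n d 0 u v t $$ (0, 0) = 1" for u v t
    by (simp add: Y_mat_def Q_poly_def P0)
  have "Ybar_mat n d 0 u v t $$ (0, 0) = 1"
    unfolding Ybar_mat_def using Y by (simp add: Y_mat_def)
  moreover have "mat_inner (E0 d) (Ybar_mat n d 0 u v t)
     = (\<Sum>i<d+1. \<Sum>j<d+1. E0 d $$ (i, j) * Ybar_mat n d 0 u v t $$ (i, j))"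
    using Ybar_mat_carrier[of n d 0 u v t] by (intro mat_inner_eq_sum) (auto simp: E0_def)
  moreover have "\<dots> = (\<Sum>i<d+1. \<Sum>j<d+1. if i = 0 then if j = 0 then Ybar_mat n d 0 u v t $$ (0, 0) else 0 else 0)"
    by (intro sum.cong refl) (auto simp: E0_def)
  moreover have "\<dots> = Ybar_mat n d 0 u v t $$ (0, 0)"
    by (subst sum.swap) (simp add: sum.If_cases sum.delta)
  ultimately show ?thesis by simp
qed

section \<open>The linear programming bound\<close>

text \<open>The lower bound of the linear programming method: all matrices contribute nonnegatively, and
  \<open>E\<^sub>0\<close> picks out of \<open>Y\<^sub>0\<close> the corner, which is constantly \<open>1\<close>, so that \<open>f\<^sub>0 E\<^sub>0\<close> contributes \<open>f\<^sub>0\<close>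
  for each pair of points.\<close>

lemma sum_eval_uvt_ge:
  fixes e :: "real ^ 'n"
  assumes n: "CARD('n) \<ge> 3" and e: "norm e = 1" and C: "\<And>c. c \<in> C \<Longrightarrow> norm c = 1"
    and F: "\<And>u v t. eval_uvt F u v t = (\<Sum>k\<le>d. mat_inner (Fm k) (Ybar_mat CARD('n) d k u v t))"
    and psd: "\<And>k. k \<le> d \<Longrightarrow> psd (d - k + 1) (Fm k)"
    and psd0: "psd (d + 1) (Fm 0 - f0 \<cdot>\<^sub>m E0 d)"
  shows "f0 * (real (card C))\<^sup>2 \<le> (\<Sum>c\<in>C. \<Sum>c'\<in>C. eval_uvt F (inner e c) (inner e c') (inner c c'))"
proof -
  define S where "S G k = (\<Sum>c\<in>C. \<Sum>c'\<in>C. mat_inner G (Ybar_mat CARD('n) d k (inner e c) (inner e c') (inner c c')))" for G k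
  have S_nonneg: "psd (d - k + 1) G \<Longrightarrow> 0 \<le> S G k" for G k
    unfolding S_def using n e C by (intro sum_mat_inner_Ybar_nonneg)
  have "mat_inner (Fm 0) (Ybar_mat CARD('n) d 0 u v t)
      = mat_inner (Fm 0 - f0 \<cdot>\<^sub>m E0 d) (Ybar_mat CARD('n) d 0 u v t) + f0" for u v t
  proof -
    have carr: "Fm 0 \<in> carrier_mat (d + 1) (d + 1)" "E0 d \<in> carrier_mat (d + 1) (d + 1)"
      "Ybar_mat CARD('n) d 0 u v t \<in> carrier_mat (d + 1) (d + 1)"
      "Fm 0 - f0 \<cdot>\<^sub>m E0 d \<in> carrier_mat (d + 1) (d + 1)"
      using psd[of 0] psd0 Ybar_mat_carrier[of _ d 0] by (auto simp: psd_def sym_mat_def E0_def)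
    have "mat_inner (Fm 0 - f0 \<cdot>\<^sub>m E0 d) (Ybar_mat CARD('n) d 0 u v t)
        = mat_inner (Fm 0) (Ybar_mat CARD('n) d 0 u v t) - f0 * mat_inner (E0 d) (Ybar_mat CARD('n) d 0 u v t)"
      unfolding mat_inner_eq_sum[OF carr(1,3)] mat_inner_eq_sum[OF carr(2,3)] mat_inner_eq_sum[OF carr(4,3)]
        sum_distrib_left sum_subtractf[symmetric]
      using carr(1,2) by (intro sum.cong refl) (simp add: algebra_simps)
    then show ?thesis using n by (simp add: mat_inner_E0_Ybar)
  qed
  then have "S (Fm 0) 0 = S (Fm 0 - f0 \<cdot>\<^sub>m E0 d) 0 + (real (card C))\<^sup>2 * f0"
    by (simp add: S_def sum.distrib power2_eq_square)
  moreover have "0 \<le> S (Fm 0 - f0 \<cdot>\<^sub>m E0 d) 0"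
    using psd0 by (intro S_nonneg) simp
  moreover have "S (Fm 0) 0 \<le> (\<Sum>k\<le>d. S (Fm k) k)"
    using psd by (intro member_le_sum S_nonneg) auto
  moreover have "(\<Sum>c\<in>C. \<Sum>c'\<in>C. eval_uvt F (inner e c) (inner e c') (inner c c')) = (\<Sum>k\<le>d. S (Fm k) k)"
    unfolding F S_def by (simp only: sum.swap[of _ "{..d}" C])
  ultimately show ?thesis by (simp add: mult.commute)
qed

text \<open>The Cauchy-Schwarz inequality for the components of \<open>x\<close> and \<open>y\<close> orthogonal to \<open>e\<close>.\<close>

lemma Gram_determinant_3_nonneg:
  fixes e x y :: "'a::real_inner"
  assumes "norm e = 1" "norm x = 1" "norm y = 1"
  shows "0 \<le> 1 + 2 * inner e x * inner e y * inner x y - (inner e x)\<^sup>2 - (inner e y)\<^sup>2 - (inner x y)\<^sup>2"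
proof -
  have one: "inner e e = 1" "inner x x = 1" "inner y y = 1"
    using assms by (simp_all add: norm_eq_1)
  have "(inner (x - inner e x *\<^sub>R e) (y - inner e y *\<^sub>R e))\<^sup>2
     \<le> inner (x - inner e x *\<^sub>R e) (x - inner e x *\<^sub>R e) * inner (y - inner e y *\<^sub>R e) (y - inner e y *\<^sub>R e)"
    by (rule Cauchy_Schwarz_ineq)
  also have "inner (x - inner e x *\<^sub>R e) (y - inner e y *\<^sub>R e) = inner x y - inner e x * inner e y"
    by (simp add: inner_diff one inner_commute)
  also have "inner (x - inner e x *\<^sub>R e) (x - inner e x *\<^sub>R e) = 1 - (inner e x)\<^sup>2"
    by (simp add: inner_diff one inner_commute power2_eq_square)
  also have "inner (y - inner e y *\<^sub>R e) (y - inner e y *\<^sub>R e) = 1 - (inner e y)\<^sup>2"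
    by (simp add: inner_diff one inner_commute power2_eq_square)
  finally show ?thesis
    by (simp add: power2_eq_square algebra_simps)
qed

theorem theorem4p4:
  fixes e :: "real ^ 'n" and \<theta> \<phi> f0 B :: real and d :: nat
    and F :: "uvt rpoly" and Fm :: "nat \<Rightarrow> real mat" and C :: "(real ^ 'n) set"
  assumes "CARD('n) \<ge> 3"
    and "e \<in> sphere 0 1"
    and "0 < \<theta>" "\<theta> \<le> pi" "0 \<le> \<phi>" "\<phi> \<le> pi"
    and "F \<in> R_poly d"
    and "\<forall>k\<le>d. sym_mat (d - k + 1) (Fm k)"
    and "\<forall>u v t. eval_uvt F u v t = (\<Sum>k\<le>d. mat_inner (Fm k) (Ybar_mat CARD('n) d k u v t))"
    and a: "\<forall>k\<le>d. psd (d - k + 1) (Fm k)"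
    and b: "psd (d + 1) (Fm 0 - f0 \<cdot>\<^sub>m E0 d)" "f0 > 0"
    and c: "\<forall>(u, v, t) \<in> Delta \<theta> \<phi>. eval_uvt F u v t \<le> 0"
    and d: "\<forall>u \<in> {cos \<phi>..1}. eval_uvt F u u 1 \<le> B"
    and "finite C" "C \<subseteq> Cap e \<phi>" "min_angular_distance_ge C \<theta>"
  shows "real (card C) \<le> B / f0"
proof -
  have e: "norm e = 1" using assms(2) by simp
  note lower = sum_eval_uvt_ge[OF assms(1) e _ assms(9)[rule_format] a[rule_format] b(1)]
  have sym: "eval_uvt F u v t = eval_uvt F v u t" for u v t
    using assms(7) by (auto simp: R_poly_def)
  have C: "norm x = 1" "cos \<phi> \<le> inner e x" "inner e x \<le> 1" if "x \<in> C" for x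
  proof -
    show "norm x = 1" "cos \<phi> \<le> inner e x" using assms(16) that by (auto simp: Cap_def)
    then show "inner e x \<le> 1" using norm_cauchy_schwarz[of e x] e by simp
  qed
  have diag: "eval_uvt F (inner e x) (inner e x) (inner x x) \<le> B" if "x \<in> C" for x
    using d C[OF that] by (simp add: norm_eq_1)
  have off: "eval_uvt F (inner e x) (inner e y) (inner x y) \<le> 0" if "x \<in> C" "y \<in> C" "x \<noteq> y" for x y
  proof -
    have *: "eval_uvt F (inner e x) (inner e y) (inner x y) \<le> 0"
      if "x \<in> C" "y \<in> C" "x \<noteq> y" "inner e x \<le> inner e y" for x y
    proof -
      have "- 1 \<le> inner x y"
        using Cauchy_Schwarz_ineq2[of x y] C that by simp
      moreover have "inner x y \<le> cos \<theta>"
        using assms(17) that by (auto simp: min_angular_distance_ge_def)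
      ultimately have "(inner e x, inner e y, inner x y) \<in> Delta \<theta> \<phi>"
        using Gram_determinant_3_nonneg[OF e, of x y] C that by (simp add: Delta_def)
      then show ?thesis using c by blast
    qed
    show ?thesis
      using *[of x y] *[of y x] that sym[of "inner e x"] inner_commute[of x y] by (metis linear)
  qed
  have "f0 * (real (card C))\<^sup>2 \<le> (\<Sum>x\<in>C. \<Sum>y\<in>C. eval_uvt F (inner e x) (inner e y) (inner x y))"
    using C by (intro lower)
  also have "\<dots> \<le> (\<Sum>x\<in>C. \<Sum>y\<in>C. if y = x then B else 0)"
    by (intro sum_mono) (use diag off in auto)
  also have "\<dots> = B * real (card C)"
    using \<open>finite C\<close> by (simp add: sum.delta)
  finally have le: "f0 * real (card C) * real (card C) \<le> B * real (card C)"
    by (simp add: power2_eq_square)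
  show ?thesis
  proof (cases "C = {}")
    case True
    \<comment> \<open>It remains to see that \<open>B\<close> is nonnegative; the code consisting of \<open>e\<close> alone shows this.\<close>
    have "f0 * (real (card {e}))\<^sup>2 \<le> (\<Sum>x\<in>{e}. \<Sum>y\<in>{e}. eval_uvt F (inner e x) (inner e y) (inner x y))"
      using e by (intro lower) auto
    then have "f0 \<le> eval_uvt F 1 1 1"
      using e by (simp add: norm_eq_1)
    also have "\<dots> \<le> B" using d by simp
    finally show ?thesis using True b(2) by simp
  next
    case False
    then have "real (card C) > 0" using \<open>finite C\<close> by (simp add: card_gt_0_iff)
    then have "f0 * real (card C) \<le> B" using le by simp
    then show ?thesis using b(2) by (simp add: field_simps)
  qed
qed

end
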